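(* Let $p>1$ and let $a(m)=\|m\|^{p^2/2}$, where $\|m\|=(\mathrm{Tr}(mm^* ))^{1/2}$. Then the operators $$(T_a(s_0)f)(m)=\frac{a(s_0^*ms_0)}{a(m)}\,f(s_0^*ms_0),\qquad s_0\in S,$$ together with the operators $(T(n)f)(m)=\exp(i\,\mathrm{Tr}(nm))f(m)$, $n\in N$, form, via $(s,n)\mapsto T_a(s)T(n)$, a representation of the group $P=S\rtimes N$ in the Hilbert space $\mathcal H=L^2(N_0^*,dm)$ that is bounded, special and nonunitary.
   Context: Let $p\ge 1$ be an integer. $S$ is the group of complex lower triangular $p\times p$ matrices $s=(s_{ij})$ with $s_{ii}>0$ for all $i$ (and $s_{ij}\in\mathbb C$ for $i>j$). $N$ is the additive group of skew-Hermitian complex $p\times p$ matrices. $P=S\rtimes N$ (the Iwasawa subgroup of $U(p,p)$) is the set of pairs $(s,n)$, $s\in S$, $n\in N$, with multiplication $(s_1,n_1)(s_2,n_2)=(s_1s_2,\ s_2^{-1}n_1(s_2^* )^{-1}+n_2)$. The dual group $N^*$ of $N$ is identified with the real vector space of skew-Hermitian $p\times p$ matrices by means of the pairing $\langle n,m\rangle=\mathrm{Tr}(nm)\in\mathbb R$; $S$ acts on $N^*$ by $m\mapsto s^*ms$. Let $dm$ be Lebesgue measure on $N^*$ (of real dimension $p^2$). Let $N_0^*=\{i s^*s : s\in S\}\subset N^*$, an $S$-orbit, and let $\mathcal H=L^2(N_0^*,dm)$ be the Hilbert space of complex functions on $N_0^*$ with norm $\|f\|^2=\int_{N_0^*}|f(m)|^2\,dm$.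 A representation $\pi$ of $P$ in $\mathcal H$ is called bounded if every operator $\pi(g)$, $g\in P$, is bounded (no uniform bound in $g$ is required); it is nonunitary if not all operators $\pi(g)$ are unitary. It is called special if it has nontrivial 1-cohomology, i.e., if there exists a map $\beta:P\to\mathcal H$ with $\beta(g_1g_2)=\beta(g_1)+\pi(g_1)\beta(g_2)$ for all $g_1,g_2\in P$ (a 1-cocycle) that is not of the form $\beta(g)=\pi(g)f-f$ for any $f\in\mathcal H$. *)

theory Defs
  imports "HOL-Analysis.Analysis" "HOL-Algebra.Group"
begin

section \<open>The group P\<close>

text \<open>
  The size \<open>p\<close> of the matrices is \<open>CARD('n)\<close>; the class \<open>wellorder\<close> (for finite types the same as
  \<open>linorder\<close>) supplies the order of the indices \<open>1, \<dots>, p\<close>.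
\<close>

type_synonym 'n cmat = "((complex, 'n) vec, 'n) vec"

definition ctranspose :: "'n::finite cmat \<Rightarrow> 'n cmat" where
  "ctranspose A = (\<chi> i j. cnj (A $ j $ i))"

definition lower_tri :: "'n::{finite,wellorder} cmat set" where
  "lower_tri = {s. (\<forall>i j. i < j \<longrightarrow> s $ i $ j = 0) \<and> (\<forall>i. s $ i $ i \<in> \<real> \<and> Re (s $ i $ i) > 0)}"

definition skew_hermitian :: "'n::finite cmat set" where
  "skew_hermitian = {n. ctranspose n = - n}"

definition P_group :: "('n::{finite,wellorder} cmat \<times> 'n cmat) monoid" where
  "P_group = \<lparr>carrier = lower_tri \<times> skew_hermitian,
     mult = (\<lambda>(s1, n1) (s2, n2).
       (s1 ** s2, matrix_inv s2 ** n1 ** matrix_inv (ctranspose s2) + n2)),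
     one = (mat 1, 0)\<rparr>"

section \<open>The orbit and its measure\<close>

definition orbit_act :: "'n::finite cmat \<Rightarrow> 'n cmat \<Rightarrow> 'n cmat" where
  "orbit_act s m = ctranspose s ** m ** s"

definition orbit0 :: "'n::{finite,wellorder} cmat set" where
  "orbit0 = (\<lambda>s. map_matrix ((*) \<i>) (ctranspose s ** s)) ` lower_tri"

text \<open>
  The real coordinates of a skew-Hermitian matrix \<open>m\<close>: \<open>Im (m $ i $ i)\<close> on the diagonal, and the real
  and imaginary parts of \<open>m $ i $ j\<close> for \<open>j < i\<close>, stored at the positions \<open>(i, j)\<close> and \<open>(j, i)\<close>.
  Lebesgue measure on the space of skew-Hermitian matrices is Lebesgue measure in these
  coordinates, regarded as a measure on all matrices that is concentrated on that space.
\<close>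

definition skew_of_coords :: "((real, 'n) vec, 'n) vec \<Rightarrow> 'n::{finite,wellorder} cmat" where
  "skew_of_coords x = (\<chi> i j.
     if i = j then Complex 0 (x $ i $ i)
     else if j < i then Complex (x $ i $ j) (x $ j $ i)
     else Complex (- (x $ j $ i)) (x $ i $ j))"

lemma linear_skew_of_coords: "linear skew_of_coords"
  by (rule linearI) (auto simp: skew_of_coords_def vec_eq_iff complex_eq_iff)

lemma bij_betw_skew_of_coords:
  "bij_betw skew_of_coords UNIV (skew_hermitian :: 'n::{finite,wellorder} cmat set)"
  unfolding bij_betw_def
proof
  show "inj (skew_of_coords :: _ \<Rightarrow> 'n cmat)"
  proof (rule injI)
    fix x y :: "((real, 'n) vec, 'n) vec"
    assume eq: "skew_of_coords x = skew_of_coords y"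
    have "x $ i $ j = y $ i $ j" for i j
    proof -
      have "skew_of_coords x $ i $ j = skew_of_coords y $ i $ j"
        "skew_of_coords x $ j $ i = skew_of_coords y $ j $ i"
        by (simp_all add: eq)
      then show ?thesis
        by (cases i j rule: linorder_cases) (auto simp: skew_of_coords_def split: if_splits)
    qed
    then show "x = y" by (simp add: vec_eq_iff)
  qed
  show "range skew_of_coords = (skew_hermitian :: 'n cmat set)"
  proof (intro equalityI subsetI)
    fix m :: "'n cmat" assume "m \<in> range skew_of_coords"
    then show "m \<in> skew_hermitian"
      by (auto simp: skew_hermitian_def ctranspose_def skew_of_coords_def vec_eq_iff complex_eq_iff)
  next
    fix m :: "'n cmat" assume "m \<in> skew_hermitian"
    then have sk: "cnj (m $ j $ i) = - (m $ i $ j)" for i j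
      by (auto simp: skew_hermitian_def ctranspose_def vec_eq_iff)
    have re: "Re (m $ j $ i) = - Re (m $ i $ j)" and im: "Im (m $ j $ i) = Im (m $ i $ j)" for i j
      using sk[of j i] by (simp_all add: complex_eq_iff)
    have dg: "Re (m $ i $ i) = 0" for i
      using re[of i i] by simp
    define x :: "((real, 'n) vec, 'n) vec" where
      "x = (\<chi> i j. if j < i then Re (m $ i $ j) else Im (m $ i $ j))"
    have "skew_of_coords x $ i $ j = m $ i $ j" for i j
      using re[of i j] im[of i j] dg[of i]
      by (auto simp: skew_of_coords_def x_def complex_eq_iff)
    then have "m = skew_of_coords x" by (simp add: vec_eq_iff)
    then show "m \<in> range skew_of_coords" by simp
  qed
qed

definition skew_lebesgue :: "'n::{finite,wellorder} cmat measure" where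
  "skew_lebesgue = distr lborel borel skew_of_coords"

definition orbit_measure :: "'n::{finite,wellorder} cmat measure" where
  "orbit_measure = restrict_space skew_lebesgue orbit0"

section \<open>The Hilbert space\<close>

definition square_integrable :: "('n::{finite,wellorder} cmat \<Rightarrow> complex) \<Rightarrow> bool" where
  "square_integrable f \<longleftrightarrow> f \<in> borel_measurable orbit_measure \<and>
     integrable orbit_measure (\<lambda>m. (cmod (f m))\<^sup>2)"

lemma borel_measurable_cnj [measurable (raw)]:
  "f \<in> borel_measurable M \<Longrightarrow> (\<lambda>x. cnj (f x)) \<in> borel_measurable M"
  by (rule measurable_compose[of _ _ borel], assumption,
      rule borel_measurable_continuous_onI, intro continuous_intros)

lemma square_integrable_mult:
  assumes "square_integrable f" "square_integrable g"
  shows "integrable orbit_measure (\<lambda>m. f m * cnj (g m))"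
proof (rule Bochner_Integration.integrable_bound)
  show "integrable orbit_measure (\<lambda>m. (cmod (f m))\<^sup>2 + (cmod (g m))\<^sup>2)"
    using assms by (simp add: square_integrable_def)
  have [measurable]: "f \<in> borel_measurable orbit_measure" "g \<in> borel_measurable orbit_measure"
    using assms by (simp_all add: square_integrable_def)
  show "(\<lambda>m. f m * cnj (g m)) \<in> borel_measurable orbit_measure"
    by measurable
  have "u * v \<le> u\<^sup>2 + v\<^sup>2" if "u \<ge> 0" "v \<ge> 0" for u v :: real
    using sum_squares_bound[of u v] that mult_nonneg_nonneg[OF that] by linarith
  then show "AE m in orbit_measure. norm (f m * cnj (g m)) \<le> norm ((cmod (f m))\<^sup>2 + (cmod (g m))\<^sup>2)"
    by (simp add: norm_mult)
qed

lemma square_integrable_zero: "square_integrable (\<lambda>_. 0)"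
  by (simp add: square_integrable_def)

lemma square_integrable_add:
  assumes "square_integrable f" "square_integrable g"
  shows "square_integrable (\<lambda>m. f m + g m)"
proof -
  have [measurable]: "f \<in> borel_measurable orbit_measure" "g \<in> borel_measurable orbit_measure"
    using assms by (simp_all add: square_integrable_def)
  have bd: "(cmod (u + v))\<^sup>2 \<le> 2 * (cmod u)\<^sup>2 + 2 * (cmod v)\<^sup>2" for u v
  proof -
    have "(cmod (u + v))\<^sup>2 \<le> (cmod u + cmod v)\<^sup>2"
      by (rule power_mono[OF norm_triangle_ineq]) simp
    also have "\<dots> \<le> 2 * (cmod u)\<^sup>2 + 2 * (cmod v)\<^sup>2"
      using sum_squares_bound[of "cmod u" "cmod v"] by (simp add: power2_sum)
    finally show ?thesis .
  qed
  have "integrable orbit_measure (\<lambda>m. (cmod (f m + g m))\<^sup>2)"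
  proof (rule Bochner_Integration.integrable_bound)
    show "integrable orbit_measure (\<lambda>m. 2 * (cmod (f m))\<^sup>2 + 2 * (cmod (g m))\<^sup>2)"
      using assms by (simp add: square_integrable_def)
  qed (use bd in auto)
  then show ?thesis by (simp add: square_integrable_def)
qed

lemma square_integrable_cmult:
  assumes "square_integrable f"
  shows "square_integrable (\<lambda>m. c * f m)"
  using assms by (auto simp: square_integrable_def norm_mult power_mult_distrib)

lemma square_integrable_uminus:
  "square_integrable f \<Longrightarrow> square_integrable (\<lambda>m. - f m)"
  using square_integrable_cmult[of f "-1"] by simp

quotient_type (overloaded) 'n orbit_L2 = "'n::{finite,wellorder} cmat \<Rightarrow> complex" / partial:
  "\<lambda>f g. square_integrable f \<and> square_integrable g \<and> (AE m in orbit_measure. f m = g m)"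
proof (rule part_equivpI)
  show "\<exists>f :: 'n cmat \<Rightarrow> complex. square_integrable f \<and> square_integrable f \<and>
      (AE m in orbit_measure. f m = f m)"
    using square_integrable_zero by auto
qed (auto intro!: sympI transpI simp: eq_commute elim: AE_mp)

instantiation orbit_L2 :: ("{finite,wellorder}") ab_group_add
begin

lift_definition zero_orbit_L2 :: "'a orbit_L2" is "\<lambda>_. 0"
  by (simp add: square_integrable_zero)

lift_definition plus_orbit_L2 :: "'a orbit_L2 \<Rightarrow> 'a orbit_L2 \<Rightarrow> 'a orbit_L2"
  is "\<lambda>f g m. f m + g m"
  by (auto simp: square_integrable_add)

lift_definition uminus_orbit_L2 :: "'a orbit_L2 \<Rightarrow> 'a orbit_L2" is "\<lambda>f m. - f m"
  by (auto simp: square_integrable_uminus)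

definition minus_orbit_L2 :: "'a orbit_L2 \<Rightarrow> 'a orbit_L2 \<Rightarrow> 'a orbit_L2" where
  "minus_orbit_L2 f g = f + - g"

instance
proof
  fix f g h :: "'a orbit_L2"
  show "f + g + h = f + (g + h)"
    by transfer (auto simp: add.assoc intro!: square_integrable_add)
  show "f + g = g + f"
    by transfer (auto simp: add.commute intro!: square_integrable_add)
  show "0 + f = f" by transfer simp
  show "- f + f = 0" by transfer (simp add: square_integrable_zero)
  show "f - g = f + - g" by (rule minus_orbit_L2_def)
qed

end

lift_definition scaleC :: "complex \<Rightarrow> 'n::{finite,wellorder} orbit_L2 \<Rightarrow> 'n orbit_L2" (infixr "*\<^sub>C" 75)
  is "\<lambda>c f m. c * f m"
  by (auto simp: square_integrable_cmult)

lift_definition cinner :: "'n::{finite,wellorder} orbit_L2 \<Rightarrow> 'n orbit_L2 \<Rightarrow> complex"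
  is "\<lambda>f g. \<integral>m. f m * cnj (g m) \<partial>orbit_measure"
proof -
  fix f f' g g' :: "'n cmat \<Rightarrow> complex"
  assume f: "square_integrable f \<and> square_integrable f' \<and> (AE m in orbit_measure. f m = f' m)"
    and g: "square_integrable g \<and> square_integrable g' \<and> (AE m in orbit_measure. g m = g' m)"
  from f g have [measurable]: "f \<in> borel_measurable orbit_measure" "f' \<in> borel_measurable orbit_measure"
    "g \<in> borel_measurable orbit_measure" "g' \<in> borel_measurable orbit_measure"
    by (simp_all add: square_integrable_def)
  show "(\<integral>m. f m * cnj (g m) \<partial>orbit_measure) = (\<integral>m. f' m * cnj (g' m) \<partial>orbit_measure)"
    by (rule integral_cong_AE) (use f g in auto)
qed

lemma cinner_add_left: "cinner (f + g) h = cinner f h + cinner g h"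
  by transfer (auto simp: distrib_right intro!: Bochner_Integration.integral_add square_integrable_mult)

lemma cinner_scaleC_left: "cinner (c *\<^sub>C f) g = c * cinner f g"
  by transfer (simp add: mult.assoc)

lemma cinner_commute: "cinner f g = cnj (cinner g f)"
proof transfer
  fix f g :: "'a cmat \<Rightarrow> complex"
  have "(\<lambda>m. f m * cnj (g m)) = (\<lambda>m. cnj (g m * cnj (f m)))"
    by (simp add: mult.commute)
  then show "(\<integral>m. f m * cnj (g m) \<partial>orbit_measure) = cnj (\<integral>m. g m * cnj (f m) \<partial>orbit_measure)"
    by (simp only: Bochner_Integration.integral_cnj)
qed

lemma cinner_self:
  "cinner f f = of_real (Re (cinner f f))" "Re (cinner f f) \<ge> 0" "cinner f f = 0 \<longleftrightarrow> f = 0"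
proof -
  show "cinner f f = of_real (Re (cinner f f))"
    using arg_cong[OF cinner_commute[of f f], of Im] by (simp add: complex_eq_iff)
  show "Re (cinner f f) \<ge> 0"
    by transfer (simp add: complex_norm_square[symmetric] del: of_real_power)
  show "cinner f f = 0 \<longleftrightarrow> f = 0"
  proof transfer
    fix f :: "'a cmat \<Rightarrow> complex"
    assume "square_integrable f \<and> square_integrable f \<and> (AE m in orbit_measure. f m = f m)"
    then have f: "square_integrable f" by simp
    have "(\<integral>m. f m * cnj (f m) \<partial>orbit_measure) = of_real (\<integral>m. (cmod (f m))\<^sup>2 \<partial>orbit_measure)"
      by (simp add: complex_norm_square[symmetric] del: of_real_power)
    moreover have "(\<integral>m. (cmod (f m))\<^sup>2 \<partial>orbit_measure) = 0 \<longleftrightarrow>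
        (AE m in orbit_measure. (cmod (f m))\<^sup>2 = 0)"
      using f by (intro integral_nonneg_eq_0_iff_AE) (auto simp: square_integrable_def)
    ultimately show "(\<integral>m. f m * cnj (f m) \<partial>orbit_measure) = 0 \<longleftrightarrow>
        square_integrable f \<and> square_integrable (\<lambda>_. 0) \<and> (AE m in orbit_measure. f m = 0)"
      using f by (simp add: square_integrable_zero)
  qed
qed

instantiation orbit_L2 :: ("{finite,wellorder}") real_vector
begin

definition scaleR_orbit_L2 :: "real \<Rightarrow> 'a orbit_L2 \<Rightarrow> 'a orbit_L2" where
  "scaleR_orbit_L2 r f = of_real r *\<^sub>C f"

instance
proof
  fix f g :: "'a orbit_L2" and r s :: real
  show "r *\<^sub>R (f + g) = r *\<^sub>R f + r *\<^sub>R g" unfolding scaleR_orbit_L2_def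
    by transfer (intro conjI AE_I2 square_integrable_add square_integrable_cmult; simp add: distrib_left)
  show "(r + s) *\<^sub>R f = r *\<^sub>R f + s *\<^sub>R f" unfolding scaleR_orbit_L2_def
    by transfer (intro conjI AE_I2 square_integrable_add square_integrable_cmult; simp add: distrib_right)
  show "r *\<^sub>R s *\<^sub>R f = (r * s) *\<^sub>R f" unfolding scaleR_orbit_L2_def
    by transfer (intro conjI AE_I2 square_integrable_add square_integrable_cmult; simp add: mult.assoc)
  show "1 *\<^sub>R f = f" unfolding scaleR_orbit_L2_def by transfer simp
qed

end

instantiation orbit_L2 :: ("{finite,wellorder}") real_inner
begin

definition inner_orbit_L2 :: "'a orbit_L2 \<Rightarrow> 'a orbit_L2 \<Rightarrow> real" where
  "inner_orbit_L2 f g = Re (cinner f g)"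
definition norm_orbit_L2 :: "'a orbit_L2 \<Rightarrow> real" where
  "norm_orbit_L2 f = sqrt (inner f f)"
definition sgn_orbit_L2 :: "'a orbit_L2 \<Rightarrow> 'a orbit_L2" where
  "sgn_orbit_L2 f = f /\<^sub>R norm f"
definition dist_orbit_L2 :: "'a orbit_L2 \<Rightarrow> 'a orbit_L2 \<Rightarrow> real" where
  "dist_orbit_L2 f g = norm (f - g)"
definition uniformity_orbit_L2 :: "('a orbit_L2 \<times> 'a orbit_L2) filter" where
  "uniformity_orbit_L2 = (INF e\<in>{0<..}. principal {(x, y). dist x y < e})"
definition open_orbit_L2 :: "'a orbit_L2 set \<Rightarrow> bool" where
  "open_orbit_L2 U \<longleftrightarrow> (\<forall>x\<in>U. \<forall>\<^sub>F (x', y) in uniformity. x' = x \<longrightarrow> y \<in> U)"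

instance
proof
  fix f g h :: "'a orbit_L2" and r :: real
  show "sgn f = f /\<^sub>R norm f" by (rule sgn_orbit_L2_def)
  show "dist f g = norm (f - g)" by (rule dist_orbit_L2_def)
  show "(uniformity :: ('a orbit_L2 \<times> 'a orbit_L2) filter) =
      (INF e\<in>{0<..}. principal {(x, y). dist x y < e})" by (rule uniformity_orbit_L2_def)
  show "open U \<longleftrightarrow> (\<forall>x\<in>U. \<forall>\<^sub>F (x', y) in uniformity. x' = x \<longrightarrow> y \<in> U)"
    for U :: "'a orbit_L2 set" by (rule open_orbit_L2_def)
  show "inner f g = inner g f"
    using arg_cong[OF cinner_commute[of f g], of Re] by (simp add: inner_orbit_L2_def)
  show "inner (f + g) h = inner f h + inner g h"
    by (simp add: inner_orbit_L2_def cinner_add_left)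
  show "inner (r *\<^sub>R f) g = r * inner f g"
    by (simp add: inner_orbit_L2_def scaleR_orbit_L2_def cinner_scaleC_left)
  show "0 \<le> inner f f" by (simp add: inner_orbit_L2_def cinner_self(2))
  show "inner f f = 0 \<longleftrightarrow> f = 0"
    using cinner_self(1,3)[of f] by (metis inner_orbit_L2_def of_real_0 zero_complex.sel(1))
  show "norm f = sqrt (inner f f)" by (rule norm_orbit_L2_def)
qed

end

section \<open>Representations and their 1-cohomology\<close>

definition clinear :: "('n::{finite,wellorder} orbit_L2 \<Rightarrow> 'n orbit_L2) \<Rightarrow> bool" where
  "clinear T \<longleftrightarrow> (\<forall>f g. T (f + g) = T f + T g) \<and> (\<forall>c f. T (c *\<^sub>C f) = c *\<^sub>C T f)"

definition GL_group :: "('n::{finite,wellorder} orbit_L2 \<Rightarrow> 'n orbit_L2) monoid" where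
  "GL_group = \<lparr>carrier = {T. clinear T \<and> bij T}, mult = (\<circ>), one = id\<rparr>"

definition unitary :: "('n::{finite,wellorder} orbit_L2 \<Rightarrow> 'n orbit_L2) \<Rightarrow> bool" where
  "unitary T \<longleftrightarrow> clinear T \<and> surj T \<and> (\<forall>f g. cinner (T f) (T g) = cinner f g)"

definition representation ::
  "('g, 'x) monoid_scheme \<Rightarrow> ('g \<Rightarrow> 'n::{finite,wellorder} orbit_L2 \<Rightarrow> 'n orbit_L2) \<Rightarrow> bool" where
  "representation G \<pi> \<longleftrightarrow> group G \<and> \<pi> \<in> hom G GL_group"

definition bounded_rep ::
  "('g, 'x) monoid_scheme \<Rightarrow> ('g \<Rightarrow> 'n::{finite,wellorder} orbit_L2 \<Rightarrow> 'n orbit_L2) \<Rightarrow> bool" where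
  "bounded_rep G \<pi> \<longleftrightarrow> (\<forall>g\<in>carrier G. bounded_linear (\<pi> g))"

definition nonunitary_rep ::
  "('g, 'x) monoid_scheme \<Rightarrow> ('g \<Rightarrow> 'n::{finite,wellorder} orbit_L2 \<Rightarrow> 'n orbit_L2) \<Rightarrow> bool" where
  "nonunitary_rep G \<pi> \<longleftrightarrow> \<not> (\<forall>g\<in>carrier G. unitary (\<pi> g))"

definition cocycle ::
  "('g, 'x) monoid_scheme \<Rightarrow> ('g \<Rightarrow> 'n::{finite,wellorder} orbit_L2 \<Rightarrow> 'n orbit_L2) \<Rightarrow>
    ('g \<Rightarrow> 'n orbit_L2) \<Rightarrow> bool" where
  "cocycle G \<pi> \<beta> \<longleftrightarrow> (\<forall>g\<in>carrier G. \<forall>h\<in>carrier G. \<beta> (g \<otimes>\<^bsub>G\<^esub> h) = \<beta> g + \<pi> g (\<beta> h))"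

definition coboundary ::
  "('g, 'x) monoid_scheme \<Rightarrow> ('g \<Rightarrow> 'n::{finite,wellorder} orbit_L2 \<Rightarrow> 'n orbit_L2) \<Rightarrow>
    ('g \<Rightarrow> 'n orbit_L2) \<Rightarrow> bool" where
  "coboundary G \<pi> \<beta> \<longleftrightarrow> (\<exists>f. \<forall>g\<in>carrier G. \<beta> g = \<pi> g f - f)"

definition special_rep ::
  "('g, 'x) monoid_scheme \<Rightarrow> ('g \<Rightarrow> 'n::{finite,wellorder} orbit_L2 \<Rightarrow> 'n orbit_L2) \<Rightarrow> bool" where
  "special_rep G \<pi> \<longleftrightarrow> (\<exists>\<beta>. cocycle G \<pi> \<beta> \<and> \<not> coboundary G \<pi> \<beta>)"

section \<open>The operators\<close>

definition matrix_norm :: "'n::finite cmat \<Rightarrow> real" where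
  "matrix_norm m = sqrt (Re (trace (m ** ctranspose m)))"

definition weight :: "'n::finite cmat \<Rightarrow> real" where
  "weight m = matrix_norm m powr (real (CARD('n)\<^sup>2) / 2)"

text \<open>
  \<open>rep_orbit_L2\<close> chooses a square integrable representative of a class. For \<open>s \<in> lower_tri\<close> and
  \<open>n \<in> skew_hermitian\<close> the results below are again square integrable and do not depend on this choice.
  For other \<open>s\<close> and \<open>n\<close> the operators carry no meaning.
\<close>

definition T_a ::
  "'n::{finite,wellorder} cmat \<Rightarrow> 'n orbit_L2 \<Rightarrow> 'n orbit_L2" where
  "T_a s f = abs_orbit_L2 (\<lambda>m.
     of_real (weight (orbit_act s m) / weight m) * rep_orbit_L2 f (orbit_act s m))"

definition T_exp ::
  "'n::{finite,wellorder} cmat \<Rightarrow> 'n orbit_L2 \<Rightarrow> 'n orbit_L2" where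
  "T_exp n f = abs_orbit_L2 (\<lambda>m. exp (\<i> * trace (n ** m)) * rep_orbit_L2 f m)"


end

theory Submission
  imports Defs
begin

text \<open>
  Conjugation by \<open>a\<close> turns \<open>T_a\<close> into translation \<open>\<phi> (m) \<mapsto> \<phi> (s\<^sup>* m s)\<close> on \<open>L\<^sup>2\<close> of the measure
  \<open>\<parallel>m\<parallel>\<^sup>-\<^sup>d dm\<close>, where \<open>d = p\<^sup>2\<close> is the dimension of \<open>N\<^sup>*\<close>. This measure is invariant under
  dilations, so the indicator of the unit ball just fails to be square integrable at the origin.
  Its coboundary under \<open>(s, n)\<close> vanishes near infinity and is \<open>O (\<parallel>m\<parallel>)\<close> near the origin, hence is square
  integrable: it is a cocycle with a formal primitive outside \<open>L\<^sup>2\<close>, and \<open>N\<close> has no invariant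
  vectors that could correct the primitive. Unitarity of \<open>T_a s\<close> would force \<open>\<parallel>s\<^sup>* m s\<parallel> / \<parallel>m\<parallel>\<close> to be
  constant on the orbit, which fails for \<open>s = diag (2, 1, \<dots>, 1)\<close> when \<open>p > 1\<close>.
\<close>

section \<open>The matrix group and its action\<close>

text \<open>The cutoff is not an element of the Hilbert space, so the group has to act on honest
  functions before it acts on classes. \<open>act_fun\<close> is that action. It is multiplicative
  at every point of the orbit, so the cocycle identity is formal and only integrability remains to
  be estimated.

  Three properties of \<open>orbit_measure\<close> carry the estimates. Elements of S multiply it by
  some positive constant whose value is irrelevant, hence no Jacobian determinant is computed. Under
  dilations the factor is exactly the power p^2, and there the exponent is decisive: it puts the
  cutoff on the borderline of integrability and makes one extra factor \<open>norm m\<close> enough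
  for convergence. Finally, relatively open nonempty pieces of the orbit have positive measure,
  because Cholesky factorization exhibits the orbit as an open cone in the real coordinates. This
  last property makes the shell in the divergence argument visible and turns integral identities
  between continuous densities, such as those that unitarity provides, into pointwise ones.\<close>

lemma ctranspose_nth [simp]: "ctranspose A $ i $ j = cnj (A $ j $ i)"
  by (simp add: ctranspose_def)

lemma ctranspose_mult: "ctranspose (A ** B) = ctranspose B ** ctranspose A"
  by (simp add: vec_eq_iff matrix_matrix_mult_def mult.commute)

lemma ctranspose_ctranspose [simp]: "ctranspose (ctranspose A) = A"
  by (simp add: vec_eq_iff)

lemma ctranspose_mat_1 [simp]: "ctranspose (mat 1) = mat 1"
  by (auto simp: vec_eq_iff mat_def)

lemma ctranspose_add: "ctranspose (A + B) = ctranspose A + ctranspose B"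
  by (simp add: vec_eq_iff)

lemma ctranspose_uminus: "ctranspose (- A) = - ctranspose A"
  by (simp add: vec_eq_iff)

lemma matrix_mult_add_rdistrib: "((A + B) ** C :: 'a::semiring_1^'n^'m) = A ** C + B ** C"
  by (simp add: vec_eq_iff matrix_matrix_mult_def distrib_right sum.distrib)

lemma matrix_mult_uminus_left: "(- A) ** B = - (A ** B :: 'n::finite cmat)"
  by (simp add: vec_eq_iff matrix_matrix_mult_def sum_negf)

lemma matrix_mult_uminus_right: "A ** (- B) = - (A ** B :: 'n::finite cmat)"
  by (simp add: vec_eq_iff matrix_matrix_mult_def sum_negf)

lemma matrix_mult_zero [simp]: "A ** 0 = (0 :: 'n::finite cmat)" "0 ** A = (0 :: 'n::finite cmat)"
  by (simp_all add: vec_eq_iff matrix_matrix_mult_def)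

lemma matrix_inv_mult:
  assumes "invertible (A :: 'a::semiring_1^'n^'n)"
  shows matrix_inv_right: "A ** matrix_inv A = mat 1" and matrix_inv_left: "matrix_inv A ** A = mat 1"
  using someI_ex[of "\<lambda>A'. A ** A' = mat 1 \<and> A' ** A = mat 1"] assms
  unfolding invertible_def matrix_inv_def by auto

lemma matrix_inv_eqI:
  fixes A B :: "'a::semiring_1^'n^'n"
  assumes "A ** B = mat 1" "B ** A = mat 1"
  shows "matrix_inv A = B"
proof -
  have inv: "invertible A" using assms unfolding invertible_def by blast
  have "matrix_inv A = matrix_inv A ** (A ** B)" using assms by simp
  also have "\<dots> = B" by (simp add: matrix_mul_assoc matrix_inv_left[OF inv])
  finally show ?thesis .
qed

section \<open>Lower triangular matrices with positive diagonal form a group\<close>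

lemma lower_triD:
  assumes "s \<in> lower_tri"
  shows "i < j \<Longrightarrow> s $ i $ j = 0" "s $ i $ i = of_real (Re (s $ i $ i))" "Re (s $ i $ i) > 0"
    "s $ i $ i \<noteq> 0"
  using assms unfolding lower_tri_def
  by (auto simp: of_real_Re) (metis less_irrefl zero_complex.sel(1))

text \<open>Asks only for the zero pattern, so that it also applies to a candidate inverse whose
  diagonal is still unknown.\<close>

lemma lower_tri_mult_diag:
  fixes A B :: "'n::{finite,wellorder} cmat"
  assumes "\<And>i j. i < j \<Longrightarrow> A $ i $ j = 0" "\<And>i j. i < j \<Longrightarrow> B $ i $ j = 0"
  shows "(A ** B) $ i $ i = A $ i $ i * B $ i $ i"
proof -
  have "(A ** B) $ i $ i = (\<Sum>k\<in>UNIV. A $ i $ k * B $ k $ i)"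
    by (simp add: matrix_matrix_mult_def)
  also have "\<dots> = (\<Sum>k\<in>{i}. A $ i $ k * B $ k $ i)"
    by (rule sum.mono_neutral_right) (use assms in \<open>auto simp: neq_iff\<close>)
  finally show ?thesis by simp
qed

lemma lower_tri_mult:
  assumes s: "s \<in> lower_tri" and t: "t \<in> lower_tri"
  shows "s ** t \<in> lower_tri"
proof -
  have "(s ** t) $ i $ j = 0" if "i < j" for i j
  proof -
    have "s $ i $ k * t $ k $ j = 0" for k
      using lower_triD(1)[OF s, of i k] lower_triD(1)[OF t, of k j] that
      by (cases "i < k") auto
    then show ?thesis by (auto simp: matrix_matrix_mult_def simp del: mult_eq_0_iff intro!: sum.neutral)
  qed
  moreover have "(s ** t) $ i $ i = of_real (Re (s $ i $ i) * Re (t $ i $ i))" for i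
    using lower_tri_mult_diag[of s t i] lower_triD[OF s] lower_triD[OF t] by simp
  ultimately show ?thesis
    using lower_triD(3)[OF s] lower_triD(3)[OF t] by (simp add: lower_tri_def)
qed

lemma mat_1_lower_tri [simp]: "mat 1 \<in> lower_tri"
  by (auto simp: lower_tri_def mat_def)

lemma lower_tri_invertible:
  assumes "s \<in> lower_tri"
  shows "invertible s"
proof -
  have "det s = (\<Prod>i\<in>UNIV. s $ i $ i)"
    using lower_triD(1)[OF assms] by (intro det_lowerdiagonal) auto
  then show ?thesis
    using lower_triD(4)[OF assms] by (simp add: invertible_det_nz)
qed

lemma lower_tri_inv:
  assumes s: "s \<in> lower_tri"
  shows "matrix_inv s \<in> lower_tri"
proof -
  define B where "B = matrix_inv s"
  have sB: "s ** B = mat 1"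
    unfolding B_def by (rule matrix_inv_right[OF lower_tri_invertible[OF s]])
  \<comment> \<open>Forward substitution. In row i of s B = 1 the terms with k > i vanish because s
    is lower triangular and those with k < i by induction, which leaves
    \<open>s $ i $ i * B $ i $ j = 0\<close>.\<close>
  have up: "B $ i $ j = 0" if "i < j" for i j
    using that
  proof (induction i rule: less_induct)
    case (less i)
    have "s $ i $ k * B $ k $ j = 0" if "k \<noteq> i" for k
      using that less lower_triD(1)[OF s, of i k] by (cases "i < k") (auto simp: neq_iff)
    then have "(\<Sum>k\<in>UNIV. s $ i $ k * B $ k $ j) = (\<Sum>k\<in>{i}. s $ i $ k * B $ k $ j)"
      by (intro sum.mono_neutral_right) auto
    moreover have "(s ** B) $ i $ j = 0"
      unfolding sB using less.prems by (simp add: mat_def)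
    ultimately show ?case
      using lower_triD(4)[OF s, of i] by (simp add: matrix_matrix_mult_def)
  qed
  have "B $ i $ i = of_real (1 / Re (s $ i $ i))" for i
  proof -
    have "s $ i $ i * B $ i $ i = 1"
      using lower_tri_mult_diag[of s B i] lower_triD(1)[OF s] up by (simp add: sB mat_def)
    then have "of_real (Re (s $ i $ i)) * B $ i $ i = 1"
      using lower_triD(2)[OF s, of i] by simp
    then show ?thesis
      using lower_triD(3)[OF s, of i] by (simp add: field_simps)
  qed
  then show ?thesis
    using up lower_triD(3)[OF s] by (simp add: lower_tri_def flip: B_def)
qed

lemma lower_tri_inv_mult:
  assumes "s \<in> lower_tri"
  shows "s ** matrix_inv s = mat 1" "matrix_inv s ** s = mat 1"
  using matrix_inv_mult[OF lower_tri_invertible[OF assms]] by auto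

lemma ctranspose_inv_mult:
  assumes "s \<in> lower_tri"
  shows "ctranspose s ** ctranspose (matrix_inv s) = mat 1"
    "ctranspose (matrix_inv s) ** ctranspose s = mat 1"
  using lower_tri_inv_mult[OF assms] by (simp_all flip: ctranspose_mult)

lemma matrix_inv_ctranspose:
  assumes "s \<in> lower_tri"
  shows "matrix_inv (ctranspose s) = ctranspose (matrix_inv s)"
  using ctranspose_inv_mult[OF assms] by (intro matrix_inv_eqI)

lemma matrix_inv_lower_tri_mult:
  assumes "s \<in> lower_tri" "t \<in> lower_tri"
  shows "matrix_inv (s ** t) = matrix_inv t ** matrix_inv s"
proof (rule matrix_inv_eqI)
  have "s ** t ** (matrix_inv t ** matrix_inv s) = s ** (t ** matrix_inv t) ** matrix_inv s"
    by (simp only: matrix_mul_assoc)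
  then show "s ** t ** (matrix_inv t ** matrix_inv s) = mat 1"
    using assms by (simp add: lower_tri_inv_mult)
  have "matrix_inv t ** matrix_inv s ** (s ** t) = matrix_inv t ** (matrix_inv s ** s) ** t"
    by (simp only: matrix_mul_assoc)
  then show "matrix_inv t ** matrix_inv s ** (s ** t) = mat 1"
    using assms by (simp add: lower_tri_inv_mult)
qed

section \<open>Skew-Hermitian matrices and the action on them\<close>

lemma skew_hermitian_zero [simp]: "0 \<in> skew_hermitian"
  by (simp add: skew_hermitian_def vec_eq_iff)

lemma skew_hermitian_uminus: "n \<in> skew_hermitian \<Longrightarrow> - n \<in> skew_hermitian"
  by (simp add: skew_hermitian_def ctranspose_uminus)

lemma skew_hermitian_add:
  "n \<in> skew_hermitian \<Longrightarrow> n' \<in> skew_hermitian \<Longrightarrow> n + n' \<in> skew_hermitian"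
  by (simp add: skew_hermitian_def ctranspose_add)

lemma skew_hermitian_conj: "n \<in> skew_hermitian \<Longrightarrow> A ** n ** ctranspose A \<in> skew_hermitian"
  by (simp add: skew_hermitian_def ctranspose_mult matrix_mult_uminus_left matrix_mult_uminus_right
      matrix_mul_assoc)

lemma orbit_act_skew: "m \<in> skew_hermitian \<Longrightarrow> orbit_act s m \<in> skew_hermitian"
  using skew_hermitian_conj[of m "ctranspose s"] by (simp add: orbit_act_def)

lemma orbit_act_mult: "orbit_act (s ** t) m = orbit_act t (orbit_act s m)"
  by (simp add: orbit_act_def ctranspose_mult matrix_mul_assoc)

lemma orbit_act_1 [simp]: "orbit_act (mat 1) m = m"
  by (simp add: orbit_act_def)

lemma orbit_act_inv:
  assumes "s \<in> lower_tri"
  shows "orbit_act (matrix_inv s) (orbit_act s m) = m" "orbit_act s (orbit_act (matrix_inv s) m) = m"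
  using lower_tri_inv_mult[OF assms] by (simp_all flip: orbit_act_mult)

section \<open>The semidirect product\<close>

lemma P_group_carrier: "carrier P_group = lower_tri \<times> skew_hermitian"
  by (simp add: P_group_def)

lemma P_group_one: "\<one>\<^bsub>P_group\<^esub> = (mat 1, 0)"
  by (simp add: P_group_def)

lemma P_group_mult:
  assumes "s2 \<in> lower_tri"
  shows "(s1, n1) \<otimes>\<^bsub>P_group\<^esub> (s2, n2) =
    (s1 ** s2, matrix_inv s2 ** n1 ** ctranspose (matrix_inv s2) + n2)"
  using assms by (simp add: P_group_def matrix_inv_ctranspose)

lemma group_P_group: "group (P_group :: ('n::{finite,wellorder} cmat \<times> 'n cmat) monoid)"
proof (rule groupI)
  fix x y :: "'n cmat \<times> 'n cmat"
  assume "x \<in> carrier P_group" "y \<in> carrier P_group"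
  then show "x \<otimes>\<^bsub>P_group\<^esub> y \<in> carrier P_group"
    by (cases x; cases y)
      (auto simp: P_group_carrier P_group_mult lower_tri_mult skew_hermitian_add skew_hermitian_conj)
next
  show "\<one>\<^bsub>P_group\<^esub> \<in> carrier (P_group :: ('n cmat \<times> 'n cmat) monoid)"
    by (simp add: P_group_carrier P_group_one)
next
  fix x y z :: "'n cmat \<times> 'n cmat"
  assume "x \<in> carrier P_group" "y \<in> carrier P_group" "z \<in> carrier P_group"
  then show "x \<otimes>\<^bsub>P_group\<^esub> y \<otimes>\<^bsub>P_group\<^esub> z = x \<otimes>\<^bsub>P_group\<^esub> (y \<otimes>\<^bsub>P_group\<^esub> z)"
    by (cases x; cases y; cases z)
      (auto simp: P_group_carrier P_group_mult lower_tri_mult matrix_inv_lower_tri_mult ctranspose_mult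
        matrix_add_ldistrib matrix_mult_add_rdistrib matrix_mul_assoc add.assoc)
next
  fix x :: "'n cmat \<times> 'n cmat"
  assume x: "x \<in> carrier P_group"
  then show "\<one>\<^bsub>P_group\<^esub> \<otimes>\<^bsub>P_group\<^esub> x = x"
    by (cases x) (auto simp: P_group_carrier P_group_one P_group_mult)
  obtain s n where sn: "x = (s, n)" "s \<in> lower_tri" "n \<in> skew_hermitian"
    using x by (cases x) (auto simp: P_group_carrier)
  \<comment> \<open>The second component solves
    \<open>matrix_inv s ** n' ** ctranspose (matrix_inv s) + n = 0\<close> for n'.\<close>
  define y where "y = (matrix_inv s, s ** (- n) ** ctranspose s)"
  have "matrix_inv s ** (s ** (- n) ** ctranspose s) ** ctranspose (matrix_inv s) =
    (matrix_inv s ** s) ** (- n) ** (ctranspose s ** ctranspose (matrix_inv s))"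
    by (simp only: matrix_mul_assoc)
  then have "y \<otimes>\<^bsub>P_group\<^esub> x = \<one>\<^bsub>P_group\<^esub>"
    using sn by (simp add: P_group_mult P_group_one y_def lower_tri_inv_mult ctranspose_inv_mult)
  moreover have "y \<in> carrier P_group"
    using sn by (simp add: y_def P_group_carrier lower_tri_inv skew_hermitian_conj skew_hermitian_uminus)
  ultimately show "\<exists>y\<in>carrier P_group. y \<otimes>\<^bsub>P_group\<^esub> x = \<one>\<^bsub>P_group\<^esub>"
    by blast
qed

text \<open>Both sides are the Frobenius norm, since the norm on nested vectors is Euclidean at both
  levels.\<close>

lemma matrix_norm_eq: "matrix_norm m = norm m"
proof -
  have "Re (trace (m ** ctranspose m)) = (\<Sum>i\<in>UNIV. \<Sum>j\<in>UNIV. (norm (m $ i $ j))\<^sup>2)"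
    by (simp add: trace_def matrix_matrix_mult_def complex_norm_square[symmetric] Re_sum
        del: of_real_power)
  also have "\<dots> = (norm m)\<^sup>2"
    by (simp add: norm_vec_def L2_set_def sum_nonneg)
  finally show ?thesis
    by (simp add: matrix_norm_def)
qed

text \<open>Conjugation reverses the factors and gives each a sign; the signs cancel and cyclicity
  of the trace restores the order. Reality of the pairing makes the multipliers of
  \<open>T_exp\<close> unimodular.\<close>

lemma trace_mult_skew_real:
  assumes "n \<in> skew_hermitian" "m \<in> skew_hermitian"
  shows "trace (n ** m) = of_real (Re (trace (n ** m)))"
proof -
  have "cnj (trace (n ** m)) = trace (ctranspose (n ** m))"
    by (simp add: trace_def)
  also have "\<dots> = trace (m ** n)"
    using assms by (simp add: ctranspose_mult skew_hermitian_def matrix_mult_uminus_left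
        matrix_mult_uminus_right)
  also have "\<dots> = trace (n ** m)" by (rule trace_mul_sym)
  finally show ?thesis by (simp add: complex_eq_iff)
qed

text \<open>The group law moves n by the transformation dual to \<open>orbit_act s\<close> under the
  trace pairing. This is what makes the phases in \<open>act_fun_mult\<close> add up.\<close>

lemma trace_conj_orbit_act:
  assumes "s \<in> lower_tri"
  shows "trace (matrix_inv s ** n ** ctranspose (matrix_inv s) ** orbit_act s m) = trace (n ** m)"
proof -
  have "matrix_inv s ** n ** ctranspose (matrix_inv s) ** orbit_act s m =
    matrix_inv s ** (n ** (ctranspose (matrix_inv s) ** ctranspose s) ** m ** s)"
    by (simp only: orbit_act_def matrix_mul_assoc)
  also have "\<dots> = matrix_inv s ** (n ** m ** s)"
    by (simp add: ctranspose_inv_mult[OF assms])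
  also have "trace \<dots> = trace (n ** m ** s ** matrix_inv s)"
    by (rule trace_mul_sym)
  also have "n ** m ** s ** matrix_inv s = n ** m"
    using lower_tri_inv_mult[OF assms] by (simp flip: matrix_mul_assoc)
  finally show ?thesis .
qed

lemma linear_orbit_act: "linear (orbit_act s)"
proof (rule linearI)
  show "orbit_act s (m + m') = orbit_act s m + orbit_act s m'" for m m'
    by (simp add: orbit_act_def matrix_add_ldistrib matrix_mult_add_rdistrib)
  show "orbit_act s (r *\<^sub>R m) = r *\<^sub>R orbit_act s m" for r m
    by (simp add: orbit_act_def vec_eq_iff matrix_matrix_mult_def flip: scaleR_sum_right)
qed

lemma bounded_linear_orbit_act: "bounded_linear (orbit_act s)"
  by (simp add: linear_orbit_act linear_conv_bounded_linear[symmetric])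

lemma bounded_linear_trace_mult: "bounded_linear (\<lambda>m. trace (n ** m :: 'n::finite cmat))"
  unfolding linear_conv_bounded_linear[symmetric]
  by (rule linearI) (simp_all add: trace_def sum.distrib matrix_matrix_mult_def distrib_left
      scaleR_sum_right)

section \<open>Linear changes of variables\<close>

lemma nn_integral_lborel_translate:
  fixes F :: "'a::euclidean_space \<Rightarrow> ennreal"
  assumes [measurable]: "F \<in> borel_measurable borel"
  shows "(\<integral>\<^sup>+ y. F (y + a) \<partial>lborel) = (\<integral>\<^sup>+ y. F y \<partial>lborel)"
proof -
  have "(\<integral>\<^sup>+ y. F y \<partial>lborel) = (\<integral>\<^sup>+ y. F y \<partial>distr lborel borel ((+) a))"
    by (simp add: lborel_distr_plus)
  also have "\<dots> = (\<integral>\<^sup>+ y. F (a + y) \<partial>lborel)"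
    by (rule nn_integral_distr) auto
  finally show ?thesis by (simp add: add.commute)
qed

lemma emeasure_lborel_open_pos:
  fixes U :: "'a::euclidean_space set"
  assumes "open U" "U \<noteq> {}"
  shows "emeasure lborel U > 0"
proof (rule ccontr)
  assume "\<not> ?thesis"
  then have "U \<in> null_sets lborel"
    using assms by (auto simp: null_sets_def)
  then have "negligible U"
    by (simp add: negligible_iff_null_sets null_sets_completionI)
  then show False
    using open_not_negligible[OF assms] by simp
qed

text \<open>
  Instead of the determinant, compute
  \<open>\<integral>\<integral> indicator E x * F (f y + x) dx dy\<close> in both orders for a set \<open>E\<close> of finite positive measure;
  translation invariance turns it into \<open>|E| \<integral> F (f y) dy\<close> and into a multiple of \<open>\<integral> F\<close>.
\<close>

lemma nn_integral_lborel_linear: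
  fixes f g :: "'a::euclidean_space \<Rightarrow> 'a"
  assumes f: "linear f" and g: "linear g" and fg: "\<And>x. f (g x) = x" and gf: "\<And>x. g (f x) = x"
  obtains c :: real where "c > 0"
    "\<And>F. F \<in> borel_measurable borel \<Longrightarrow>
      (\<integral>\<^sup>+ y. F (f y) \<partial>lborel) = ennreal c * (\<integral>\<^sup>+ y. F y \<partial>lborel)"
proof -
  have contf: "continuous_on UNIV f" and contg: "continuous_on UNIV g"
    using f g by (auto simp: linear_continuous_on linear_linear)
  have [measurable]: "f \<in> borel_measurable borel"
    using contf by (rule borel_measurable_continuous_onI)
  define E where "E = ball (0::'a) 1"
  \<comment> \<open>For each x the set of y with \<open>x - f y\<close> in E is a translate of D, by
    \<open>g x\<close>; so all these sets have the measure of D, which is what \<open>shD\<close>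
    uses.\<close>
  define D where "D = {y. - f y \<in> E}"
  have [measurable]: "E \<in> sets borel" by (simp add: E_def)
  have openD: "open D"
  proof -
    have "D = (\<lambda>y. - f y) -` E" by (auto simp: D_def)
    then show ?thesis
      using contf by (auto simp: E_def intro!: open_vimage continuous_intros)
  qed
  then have [measurable]: "D \<in> sets borel" by simp
  have "0 \<in> D" using linear_0[OF f] by (simp add: D_def E_def)
  have posD: "emeasure lborel D > 0"
    using openD \<open>0 \<in> D\<close> by (intro emeasure_lborel_open_pos) auto
  have "D \<subseteq> g ` cball 0 1"
  proof
    fix y assume "y \<in> D"
    then have "f y \<in> cball 0 1" by (simp add: D_def E_def)
    then show "y \<in> g ` cball 0 1" by (metis gf image_eqI)
  qed
  moreover have "compact (g ` cball 0 1)"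
    using contg continuous_on_subset by (intro compact_continuous_image) auto
  ultimately have finD: "emeasure lborel D < \<infinity>"
    by (metis emeasure_bounded_finite bounded_subset compact_imp_bounded)
  have posE: "emeasure lborel E > 0"
    by (intro emeasure_lborel_open_pos) (auto simp: E_def)
  have finE: "emeasure lborel E < \<infinity>" unfolding E_def by (rule emeasure_lborel_ball_finite)
  have key: "emeasure lborel E * (\<integral>\<^sup>+ y. F (f y) \<partial>lborel) = emeasure lborel D * (\<integral>\<^sup>+ y. F y \<partial>lborel)"
    if [measurable]: "F \<in> borel_measurable borel" for F
  proof -
    have sh: "(\<integral>\<^sup>+ y. F (f y) \<partial>lborel) = (\<integral>\<^sup>+ y. F (f y + x) \<partial>lborel)" for x
      using nn_integral_lborel_translate[of "\<lambda>y. F (f y)" "g x"] by (simp add: linear_add[OF f] fg)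
    have shD: "(\<integral>\<^sup>+ y. indicator E (x - f y) \<partial>lborel) = emeasure lborel D" for x
    proof -
      have "(\<integral>\<^sup>+ y. indicator E (x - f y) \<partial>lborel) = (\<integral>\<^sup>+ y. indicator E (x - f (y + g x)) \<partial>lborel)"
        by (rule nn_integral_lborel_translate[symmetric]) measurable
      also have "\<dots> = (\<integral>\<^sup>+ y. indicator D y \<partial>lborel)"
        by (intro nn_integral_cong) (simp add: linear_add[OF f] fg D_def indicator_def)
      finally show ?thesis by simp
    qed
    have "emeasure lborel E * (\<integral>\<^sup>+ y. F (f y) \<partial>lborel) =
        (\<integral>\<^sup>+ x. indicator E x * (\<integral>\<^sup>+ y. F (f y) \<partial>lborel) \<partial>lborel)"
      by (subst nn_integral_multc) auto
    also have "\<dots> = (\<integral>\<^sup>+ x. (\<integral>\<^sup>+ y. indicator E x * F (f y + x) \<partial>lborel) \<partial>lborel)"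
      by (intro nn_integral_cong) (subst nn_integral_cmult, measurable, simp add: sh[symmetric])
    also have "\<dots> = (\<integral>\<^sup>+ y. (\<integral>\<^sup>+ x. indicator E x * F (f y + x) \<partial>lborel) \<partial>lborel)"
      by (rule lborel_pair.Fubini'[symmetric]) measurable
    also have "\<dots> = (\<integral>\<^sup>+ y. (\<integral>\<^sup>+ x. indicator E (x - f y) * F x \<partial>lborel) \<partial>lborel)"
    proof (rule nn_integral_cong)
      fix y
      have "(\<integral>\<^sup>+ x. indicator E (x - f y) * F x \<partial>lborel) =
          (\<integral>\<^sup>+ x. indicator E (x + f y - f y) * F (x + f y) \<partial>lborel)"
        by (rule nn_integral_lborel_translate[symmetric]) measurable
      then show "(\<integral>\<^sup>+ x. indicator E x * F (f y + x) \<partial>lborel) =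
          (\<integral>\<^sup>+ x. indicator E (x - f y) * F x \<partial>lborel)"
        by (simp add: add.commute)
    qed
    also have "\<dots> = (\<integral>\<^sup>+ x. (\<integral>\<^sup>+ y. indicator E (x - f y) * F x \<partial>lborel) \<partial>lborel)"
      by (rule lborel_pair.Fubini') measurable
    also have "\<dots> = (\<integral>\<^sup>+ x. emeasure lborel D * F x \<partial>lborel)"
    proof (rule nn_integral_cong)
      fix x
      have "(\<integral>\<^sup>+ y. indicator E (x - f y) * F x \<partial>lborel) = (\<integral>\<^sup>+ y. indicator E (x - f y) \<partial>lborel) * F x"
        by (rule nn_integral_multc) measurable
      then show "(\<integral>\<^sup>+ y. indicator E (x - f y) * F x \<partial>lborel) = emeasure lborel D * F x"
        by (simp only: shD)
    qed
    also have "\<dots> = emeasure lborel D * (\<integral>\<^sup>+ x. F x \<partial>lborel)"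
      by (rule nn_integral_cmult) measurable
    finally show ?thesis .
  qed
  obtain e where mE: "emeasure lborel E = ennreal e" "e > 0"
    using posE finE by (cases "emeasure lborel E") auto
  obtain d where mD: "emeasure lborel D = ennreal d" "d > 0"
    using posD finD by (cases "emeasure lborel D") auto
  define c where "c = d / e"
  show thesis
  proof (rule that)
    show "c > 0" using mE mD by (simp add: c_def)
    fix F :: "'a \<Rightarrow> ennreal" assume "F \<in> borel_measurable borel"
    note k = key[OF this]
    have "(\<integral>\<^sup>+ y. F (f y) \<partial>lborel) =
        ennreal (1 / e) * (ennreal e * (\<integral>\<^sup>+ y. F (f y) \<partial>lborel))"
      using mE(2) by (simp add: mult.assoc[symmetric] ennreal_mult[symmetric])
    also have "\<dots> = ennreal (1 / e) * (ennreal d * (\<integral>\<^sup>+ y. F y \<partial>lborel))"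
      using k mE mD by simp
    also have "\<dots> = ennreal c * (\<integral>\<^sup>+ y. F y \<partial>lborel)"
      using mE mD by (simp add: mult.assoc[symmetric] ennreal_mult[symmetric] c_def)
    finally show "(\<integral>\<^sup>+ y. F (f y) \<partial>lborel) = ennreal c * (\<integral>\<^sup>+ y. F y \<partial>lborel)" .
  qed
qed

section \<open>The orbit and its measure\<close>

text \<open>Defined linearly on all matrices, although it inverts \<open>skew_of_coords\<close> only
  on the skew-Hermitian ones.\<close>

definition skew_coords :: "'n::{finite,wellorder} cmat \<Rightarrow> ((real, 'n) vec, 'n) vec" where
  "skew_coords m = (\<chi> i j. if j < i then Re (m $ i $ j) else Im (m $ i $ j))"

lemma skew_coords_of_coords [simp]: "skew_coords (skew_of_coords x) = x"
  by (auto simp: skew_coords_def skew_of_coords_def vec_eq_iff)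

lemma skew_of_coords_skew [simp]: "skew_of_coords x \<in> skew_hermitian"
  using bij_betw_skew_of_coords by (auto simp: bij_betw_def)

lemma skew_of_coords_coords:
  assumes "m \<in> skew_hermitian"
  shows "skew_of_coords (skew_coords m) = m"
proof -
  obtain x where "m = skew_of_coords x"
    using assms bij_betw_skew_of_coords unfolding bij_betw_def by blast
  then show ?thesis by simp
qed

lemma skew_coords_eqD:
  assumes "m \<in> skew_hermitian" "m' \<in> skew_hermitian" "skew_coords m = skew_coords m'"
  shows "m = m'"
  using assms skew_of_coords_coords by metis

lemma linear_skew_coords: "linear skew_coords"
  by (rule linearI) (auto simp: skew_coords_def vec_eq_iff)

lemma continuous_skew_coords: "continuous_on A skew_coords"
  and continuous_skew_of_coords: "continuous_on B skew_of_coords"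
  by (auto intro: linear_continuous_on simp: linear_linear linear_skew_coords linear_skew_of_coords)

lemma continuous_orbit_act: "continuous_on A (orbit_act s)"
  by (auto intro: linear_continuous_on bounded_linear_orbit_act)

lemma measurable_orbit_act_borel [measurable]: "orbit_act s \<in> borel_measurable borel"
  by (auto intro: borel_measurable_continuous_onI continuous_orbit_act)

lemma measurable_skew_of_coords [measurable]: "skew_of_coords \<in> borel_measurable borel"
  by (auto intro: borel_measurable_continuous_onI continuous_skew_of_coords)

section \<open>The orbit as a cone of Gram matrices\<close>

definition gram :: "'n::finite cmat \<Rightarrow> 'n cmat" where
  "gram s = map_matrix ((*) \<i>) (ctranspose s ** s)"

lemma orbit0_eq_gram: "orbit0 = gram ` lower_tri"
  by (simp add: orbit0_def gram_def)

lemma gram_nth: "gram s $ i $ j = \<i> * (\<Sum>k\<in>UNIV. cnj (s $ k $ i) * s $ k $ j)"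
  by (simp add: gram_def matrix_matrix_mult_def)

lemma gram_skew: "gram s \<in> skew_hermitian"
  by (simp add: skew_hermitian_def vec_eq_iff gram_nth mult.commute)

lemma orbit0_skew: "m \<in> orbit0 \<Longrightarrow> m \<in> skew_hermitian"
  by (auto simp: orbit0_eq_gram gram_skew)

text \<open>\<open>gram s\<close> is \<open>orbit_act s\<close> applied to the base point i 1, so
  this is the equivariance of the orbit map; stability of the orbit under S follows from it.\<close>

lemma gram_mult: "gram (s ** t) = orbit_act t (gram s)"
proof -
  have scal: "map_matrix ((*) \<i>) (A ** M) = A ** map_matrix ((*) \<i>) M"
     "map_matrix ((*) \<i>) (M ** A) = map_matrix ((*) \<i>) M ** A" for A M :: "'a cmat"
    by (simp_all add: vec_eq_iff matrix_matrix_mult_def sum_distrib_left mult_ac)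
  have "ctranspose (s ** t) ** (s ** t) = ctranspose t ** ((ctranspose s ** s) ** t)"
    by (simp only: ctranspose_mult matrix_mul_assoc)
  then have "gram (s ** t) = ctranspose t ** (gram s ** t)"
    unfolding gram_def by (simp only: scal(1)[of "ctranspose t"] scal(2)[of _ t])
  then show ?thesis by (simp only: orbit_act_def matrix_mul_assoc)
qed

lemma orbit_act_orbit0:
  assumes "s \<in> lower_tri" "m \<in> orbit0"
  shows "orbit_act s m \<in> orbit0"
  using assms lower_tri_mult by (force simp: orbit0_eq_gram gram_mult[symmetric])

lemma orbit_act_orbit0_iff:
  assumes "s \<in> lower_tri"
  shows "orbit_act s m \<in> orbit0 \<longleftrightarrow> m \<in> orbit0"
  using orbit_act_orbit0[OF assms] orbit_act_orbit0[OF lower_tri_inv[OF assms], of "orbit_act s m"]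
  by (auto simp: orbit_act_inv[OF assms])

text \<open>The orbit is a cone: \<open>gram\<close> is quadratic, so scaling m by t amounts to
  scaling s by \<open>sqrt t\<close>, which keeps the diagonal positive.\<close>

lemma scaleR_orbit0:
  assumes "t > 0" "m \<in> orbit0"
  shows "t *\<^sub>R m \<in> orbit0"
proof -
  obtain s where s: "s \<in> lower_tri" "m = gram s"
    using assms by (auto simp: orbit0_eq_gram)
  have "sqrt t *\<^sub>R s \<in> lower_tri"
    using s assms by (auto simp: lower_tri_def complex_is_Real_iff)
  moreover have "gram (sqrt t *\<^sub>R s) = t *\<^sub>R m"
    using assms by (simp add: s vec_eq_iff gram_nth flip: power2_eq_square scaleR_sum_right)
  ultimately show ?thesis by (metis image_eqI orbit0_eq_gram)
qed

lemma scaleR_orbit0_iff: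
  assumes "t > 0"
  shows "t *\<^sub>R m \<in> orbit0 \<longleftrightarrow> m \<in> orbit0"
  using scaleR_orbit0[OF assms, of m] scaleR_orbit0[of "1/t" "t *\<^sub>R m"] assms by auto

lemma zero_notin_orbit0: "0 \<notin> (orbit0 :: 'n::{finite,wellorder} cmat set)"
proof
  assume "0 \<in> (orbit0 :: 'n cmat set)"
  then obtain s :: "'n cmat" where s: "s \<in> lower_tri" "gram s = 0"
    by (auto simp: orbit0_eq_gram)
  fix i :: 'n
  have "Re (\<Sum>k\<in>UNIV. cnj (s $ k $ i) * s $ k $ i) = 0"
    using s gram_nth[of s i i] by simp
  then have "(\<Sum>k\<in>UNIV. (cmod (s $ k $ i))\<^sup>2) = 0"
    by (simp add: Re_sum mult.commute[of "cnj _"] complex_norm_square[symmetric] del: of_real_power)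
  then have "s $ i $ i = 0"
    by (subst (asm) sum_nonneg_eq_0_iff) auto
  then show False using lower_triD(4)[OF s(1)] by simp
qed

text \<open>The inverse of u is its conjugate transpose, hence lower and upper triangular at once.
  So u is diagonal, with positive entries of modulus 1.\<close>

lemma lower_tri_unitary_eq_1:
  assumes u: "u \<in> lower_tri" and uu: "ctranspose u ** u = mat 1"
  shows "u = mat 1"
proof -
  have "u ** ctranspose u = mat 1"
    using uu matrix_left_right_inverse by blast
  then have "ctranspose u = matrix_inv u"
    using uu matrix_inv_eqI[of u "ctranspose u"] by simp
  then have cu: "ctranspose u \<in> lower_tri" using lower_tri_inv[OF u] by simp
  have "u $ i $ j = 0" if "i \<noteq> j" for i j
    using that lower_triD(1)[OF u, of i j] lower_triD(1)[OF cu, of j i] by (cases "i < j") auto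
  moreover have "u $ i $ i = 1" for i
  proof -
    have "(ctranspose u ** u) $ i $ i = cnj (u $ i $ i) * u $ i $ i"
      using lower_tri_mult_diag[of "ctranspose u" u i] lower_triD(1)[OF u] lower_triD(1)[OF cu] by simp
    also have "\<dots> = of_real ((Re (u $ i $ i))\<^sup>2)"
      using lower_triD(2)[OF u, of i] by (metis complex_cnj_complex_of_real of_real_mult power2_eq_square)
    finally have "(Re (u $ i $ i))\<^sup>2 = 1"
      unfolding uu by (simp add: mat_def del: of_real_power)
    then have "Re (u $ i $ i) = 1"
      using lower_triD(3)[OF u, of i] by (simp add: power2_eq_1_iff)
    then show ?thesis using lower_triD(2)[OF u, of i] by simp
  qed
  ultimately show ?thesis by (auto simp: vec_eq_iff mat_def)
qed

text \<open>Uniqueness of the Cholesky factor: if s and t give the same matrix, then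
  \<open>t ** matrix_inv s\<close> is unitary and lies in \<open>lower_tri\<close>.\<close>

lemma inj_on_gram: "inj_on gram lower_tri"
proof (rule inj_onI)
  fix s t :: "'n::{finite,wellorder} cmat"
  assume s: "s \<in> lower_tri" and t: "t \<in> lower_tri" and eq: "gram s = gram t"
  have e: "ctranspose s ** s = ctranspose t ** t"
    using eq by (simp add: gram_def vec_eq_iff)
  define u where "u = t ** matrix_inv s"
  have "ctranspose u ** u = ctranspose (matrix_inv s) ** (ctranspose t ** t) ** matrix_inv s"
    by (simp only: u_def ctranspose_mult matrix_mul_assoc)
  also have "\<dots> = (ctranspose (matrix_inv s) ** ctranspose s) ** (s ** matrix_inv s)"
    by (simp only: e[symmetric] matrix_mul_assoc)
  also have "\<dots> = mat 1" by (simp add: ctranspose_inv_mult[OF s] lower_tri_inv_mult[OF s])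
  finally have uu: "ctranspose u ** u = mat 1" .
  have "u \<in> lower_tri"
    unfolding u_def by (intro lower_tri_mult lower_tri_inv s t)
  then have "u = mat 1"
    using uu by (rule lower_tri_unitary_eq_1)
  then have "u ** s = s" by simp
  then show "s = t"
    using lower_tri_inv_mult[OF s] by (simp add: u_def flip: matrix_mul_assoc)
qed

text \<open>Follows the storage scheme of \<open>skew_of_coords\<close>, so that the Cholesky map
  becomes a map of one Euclidean space into itself, as invariance of domain demands.
  \<open>lower_tri\<close> corresponds to the open set of coordinates with positive
  diagonal.\<close>

definition tri_of_coords :: "((real, 'n) vec, 'n) vec \<Rightarrow> 'n::{finite,wellorder} cmat" where
  "tri_of_coords y = (\<chi> i j.
     if i = j then of_real (y $ i $ i) else if j < i then Complex (y $ i $ j) (y $ j $ i) else 0)"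

lemma linear_tri_of_coords: "linear tri_of_coords"
  by (rule linearI) (auto simp: tri_of_coords_def vec_eq_iff complex_eq_iff)

lemma inj_tri_of_coords: "inj tri_of_coords"
proof (rule injI)
  fix x y :: "((real, 'n::{finite,wellorder}) vec, 'n) vec"
  assume eq: "tri_of_coords x = tri_of_coords y"
  have "x $ i $ j = y $ i $ j" for i j
  proof -
    have "tri_of_coords x $ i $ j = tri_of_coords y $ i $ j"
      "tri_of_coords x $ j $ i = tri_of_coords y $ j $ i"
      by (simp_all add: eq)
    then show ?thesis
      by (cases i j rule: linorder_cases) (auto simp: tri_of_coords_def split: if_splits)
  qed
  then show "x = y" by (simp add: vec_eq_iff)
qed

lemma lower_tri_eq_tri_of_coords: "lower_tri = tri_of_coords ` {y. \<forall>i. y $ i $ i > 0}"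
proof (intro equalityI subsetI)
  fix s :: "'n::{finite,wellorder} cmat" assume s: "s \<in> lower_tri"
  define y :: "((real, 'n) vec, 'n) vec" where
    "y = (\<chi> i j. if j \<le> i then Re (s $ i $ j) else Im (s $ j $ i))"
  have "tri_of_coords y = s"
    using lower_triD[OF s] by (auto simp: tri_of_coords_def y_def vec_eq_iff complex_eq_iff not_less)
  moreover have "\<forall>i. y $ i $ i > 0" using lower_triD(3)[OF s] by (simp add: y_def)
  ultimately show "s \<in> tri_of_coords ` {y. \<forall>i. y $ i $ i > 0}" by blast
qed (auto simp: lower_tri_def tri_of_coords_def)

text \<open>Invariance of domain, applied to the Cholesky parametrization of the orbit.\<close>

lemma open_coords_orbit0: "open (skew_coords ` (orbit0 :: 'n::{finite,wellorder} cmat set))"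
proof -
  define U where "U = {y :: ((real, 'n) vec, 'n) vec. \<forall>i. y $ i $ i > 0}"
  define h where "h = (\<lambda>y :: ((real, 'n) vec, 'n) vec. skew_coords (gram (tri_of_coords y)))"
  have "U = (\<Inter>i. {y. 0 < y $ i $ i})" by (auto simp: U_def)
  then have "open U"
    by (auto intro!: open_INT open_Collect_less continuous_intros)
  have "continuous_on UNIV tri_of_coords"
    by (intro linear_continuous_on) (simp add: linear_linear linear_tri_of_coords)
  moreover have "continuous_on UNIV (gram :: 'n cmat \<Rightarrow> _)"
  proof -
    have "gram = (\<lambda>s :: 'n cmat. \<chi> i j. \<i> * (\<Sum>k\<in>UNIV. cnj (s $ k $ i) * s $ k $ j))"
      by (simp add: fun_eq_iff vec_eq_iff gram_nth)
    moreover have "continuous_on UNIV \<dots>"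
      by (intro continuous_intros)
    ultimately show ?thesis by metis
  qed
  ultimately have "continuous_on UNIV (\<lambda>y. gram (tri_of_coords y) :: 'n cmat)"
    by (intro continuous_on_compose2[of UNIV gram UNIV tri_of_coords]) auto
  then have "continuous_on UNIV h"
    unfolding h_def by (rule continuous_on_compose2[OF continuous_skew_coords]) auto
  moreover have "inj_on h U"
  proof (rule inj_onI)
    fix x y assume xy: "x \<in> U" "y \<in> U" "h x = h y"
    then have "gram (tri_of_coords x) = gram (tri_of_coords y)"
      unfolding h_def by (intro skew_coords_eqD[OF gram_skew gram_skew])
    moreover have "tri_of_coords x \<in> lower_tri" "tri_of_coords y \<in> lower_tri"
      using xy by (auto simp: lower_tri_eq_tri_of_coords U_def)
    ultimately have "tri_of_coords x = tri_of_coords y"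
      using inj_on_gram by (auto dest: inj_onD)
    then show "x = y" using inj_tri_of_coords by (auto dest: injD)
  qed
  ultimately have "open (h ` U)"
    using \<open>open U\<close> by (intro invariance_of_domain) (auto intro: continuous_on_subset)
  moreover have "h ` U = skew_coords ` orbit0"
    by (auto simp: h_def U_def orbit0_eq_gram lower_tri_eq_tri_of_coords)
  ultimately show ?thesis by simp
qed

lemma skew_of_coords_in_orbit0_iff: "skew_of_coords x \<in> orbit0 \<longleftrightarrow> x \<in> skew_coords ` orbit0"
  by (metis image_iff orbit0_skew skew_coords_of_coords skew_of_coords_coords)

lemma closed_skew_hermitian: "closed (skew_hermitian :: 'n::finite cmat set)"
proof -
  have "skew_hermitian = (\<Inter>i. \<Inter>j. {m :: 'n cmat. cnj (m $ j $ i) = - (m $ i $ j)})"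
    by (auto simp: skew_hermitian_def vec_eq_iff)
  moreover have single: "closed {m :: 'n cmat. cnj (m $ j $ i) = - (m $ i $ j)}" for i j
    by (intro closed_Collect_eq continuous_intros)
  have "closed (\<Inter>i. \<Inter>j. {m :: 'n cmat. cnj (m $ j $ i) = - (m $ i $ j)})"
    by (rule closed_INT, rule ballI, rule closed_INT, rule ballI, rule single)
  ultimately show ?thesis by simp
qed

text \<open>The orbit is not open among all matrices. It is relatively open in the closed subspace
  of skew-Hermitian ones, hence the intersection of an open and a closed set.\<close>

lemma orbit0_borel [measurable]: "orbit0 \<in> sets borel"
proof -
  have "orbit0 = skew_coords -` (skew_coords ` orbit0) \<inter> (skew_hermitian :: 'a cmat set)"
    using orbit0_skew by (auto simp: image_iff) (metis skew_of_coords_coords)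
  moreover have "open (skew_coords -` (skew_coords ` (orbit0 :: 'a cmat set)))"
    by (intro open_vimage open_coords_orbit0 continuous_skew_coords)
  ultimately show ?thesis
    using closed_skew_hermitian by (metis borel_closed borel_open sets.Int)
qed

section \<open>Integration over the orbit\<close>

lemma space_orbit_measure [simp]: "space orbit_measure = orbit0"
  by (simp add: orbit_measure_def skew_lebesgue_def space_restrict_space)

lemma sets_orbit_measure [measurable_cong]: "sets orbit_measure = sets (restrict_space borel orbit0)"
  unfolding orbit_measure_def by (rule sets_restrict_space_cong) (simp add: skew_lebesgue_def)

lemma measurable_borel_orbit_measure:
  "f \<in> borel_measurable borel \<Longrightarrow> f \<in> borel_measurable orbit_measure"
  by (simp add: measurable_cong_sets[OF sets_orbit_measure refl] measurable_restrict_space1)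

text \<open>Reduces integrals over the orbit to Lebesgue integrals in coordinates. As F is
  measurable only on the orbit, the integrand is cut off there, and its measurability is recorded
  for later changes of variables.\<close>

lemma nn_integral_orbit_measure:
  assumes "F \<in> borel_measurable orbit_measure"
  shows "(\<integral>\<^sup>+ m. F m \<partial>orbit_measure) =
      (\<integral>\<^sup>+ x. F (skew_of_coords x) * indicator orbit0 (skew_of_coords x) \<partial>lborel)"
    and "(\<lambda>x. F (skew_of_coords x) * indicator orbit0 (skew_of_coords x)) \<in> borel_measurable borel"
proof -
  have "F \<in> borel_measurable (restrict_space borel orbit0)"
    using assms by (simp add: measurable_cong_sets[OF sets_orbit_measure refl])
  then have [measurable]: "(\<lambda>m. F m * indicator orbit0 m) \<in> borel_measurable borel"
    by (subst (asm) borel_measurable_restrict_space_iff_ennreal) auto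
  have "(\<integral>\<^sup>+ m. F m \<partial>orbit_measure) = (\<integral>\<^sup>+ m. F m * indicator orbit0 m \<partial>skew_lebesgue)"
    unfolding orbit_measure_def
    by (rule nn_integral_restrict_space) (simp add: skew_lebesgue_def)
  also have "\<dots> = (\<integral>\<^sup>+ x. F (skew_of_coords x) * indicator orbit0 (skew_of_coords x) \<partial>lborel)"
    unfolding skew_lebesgue_def by (rule nn_integral_distr) measurable
  finally show "(\<integral>\<^sup>+ m. F m \<partial>orbit_measure) =
      (\<integral>\<^sup>+ x. F (skew_of_coords x) * indicator orbit0 (skew_of_coords x) \<partial>lborel)" .
  show "(\<lambda>x. F (skew_of_coords x) * indicator orbit0 (skew_of_coords x)) \<in> borel_measurable borel"
    by measurable
qed

lemma measurable_orbit_act [measurable]: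
  assumes "s \<in> lower_tri"
  shows "orbit_act s \<in> measurable orbit_measure orbit_measure"
proof -
  have "orbit_act s \<in> measurable (restrict_space borel orbit0) (restrict_space borel orbit0)"
    using orbit_act_orbit0[OF assms]
    by (intro measurable_restrict_space3) auto
  then show ?thesis
    by (simp add: measurable_cong_sets[OF sets_orbit_measure sets_orbit_measure])
qed

text \<open>In coordinates \<open>orbit_act s\<close> is an invertible linear map that preserves the
  orbit. The constant is the inverse of its absolute Jacobian; what counts is that it is positive
  and finite.\<close>

lemma nn_integral_orbit_act:
  assumes s: "s \<in> lower_tri"
  obtains c :: real where "c > 0"
    "\<And>F. F \<in> borel_measurable orbit_measure \<Longrightarrow>
      (\<integral>\<^sup>+ m. F (orbit_act s m) \<partial>orbit_measure) = ennreal c * (\<integral>\<^sup>+ m. F m \<partial>orbit_measure)"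
proof -
  define f where "f = (\<lambda>x. skew_coords (orbit_act s (skew_of_coords x)))"
  define g where "g = (\<lambda>x. skew_coords (orbit_act (matrix_inv s) (skew_of_coords x)))"
  have sf: "skew_of_coords (f x) = orbit_act s (skew_of_coords x)" for x
    by (simp add: f_def skew_of_coords_coords orbit_act_skew)
  have lin: "linear f" "linear g"
    unfolding f_def g_def
    using linear_compose[OF linear_compose[OF linear_skew_of_coords linear_orbit_act] linear_skew_coords]
    by (auto simp: o_def)
  have "f (g x) = x" "g (f x) = x" for x
    by (simp_all add: f_def g_def skew_of_coords_coords orbit_act_skew orbit_act_inv[OF s])
  from nn_integral_lborel_linear[OF lin this] obtain c where c: "c > 0"
    "\<And>F. F \<in> borel_measurable borel \<Longrightarrow>
      (\<integral>\<^sup>+ y. F (f y) \<partial>lborel) = ennreal c * (\<integral>\<^sup>+ y. F y \<partial>lborel)" by metis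
  show thesis
  proof (rule that[OF c(1)])
    fix F :: "'a cmat \<Rightarrow> ennreal" assume F: "F \<in> borel_measurable orbit_measure"
    have "(\<lambda>m. F (orbit_act s m)) \<in> borel_measurable orbit_measure"
      using measurable_compose[OF measurable_orbit_act[OF s] F] .
    then show "(\<integral>\<^sup>+ m. F (orbit_act s m) \<partial>orbit_measure) = ennreal c * (\<integral>\<^sup>+ m. F m \<partial>orbit_measure)"
      using c(2)[OF nn_integral_orbit_measure(2)[OF F]]
      by (simp add: nn_integral_orbit_measure(1) F sf indicator_def orbit_act_orbit0_iff[OF s])
  qed
qed

text \<open>Here the exact factor matters: the exponent is the number of real coordinates, to which
  the exponent of \<open>weight\<close> is tuned. The orbit being a cone, its indicator is
  unaffected.\<close>

lemma nn_integral_orbit_scaleR: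
  fixes F :: "'n::{finite,wellorder} cmat \<Rightarrow> ennreal"
  assumes F: "F \<in> borel_measurable borel" and t: "t > 0"
  shows "(\<integral>\<^sup>+ m. F m \<partial>orbit_measure) =
      ennreal (t ^ (CARD('n))\<^sup>2) * (\<integral>\<^sup>+ m. F (t *\<^sub>R m) \<partial>orbit_measure)"
proof -
  let ?G = "\<lambda>x. F (skew_of_coords x) * indicator orbit0 (skew_of_coords x)"
  have [measurable]: "F \<in> borel_measurable borel" by fact
  have G [measurable]: "?G \<in> borel_measurable borel" by measurable
  let ?L = "lborel :: ((real, 'n) vec, 'n) vec measure"
  have D: "DIM(((real, 'n) vec, 'n) vec) = (CARD('n))\<^sup>2"
    by (simp add: power2_eq_square)
  have "(\<integral>\<^sup>+ m. F m \<partial>orbit_measure) = (\<integral>\<^sup>+ x. ?G x \<partial>?L)"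
    by (intro nn_integral_orbit_measure measurable_borel_orbit_measure F)
  also have "\<dots> = (\<integral>\<^sup>+ x. ?G x \<partial>density (distr ?L borel (\<lambda>x. 0 + t *\<^sub>R x)) (\<lambda>_. \<bar>t\<bar> ^ (CARD('n))\<^sup>2))"
    using lborel_affine[of t "0 :: ((real, 'n) vec, 'n) vec"] t D by simp
  also have "\<dots> = ennreal (t ^ (CARD('n))\<^sup>2) * (\<integral>\<^sup>+ x. ?G (t *\<^sub>R x) \<partial>?L)"
    using t by (simp add: nn_integral_density nn_integral_cmult nn_integral_distr)
  also have "(\<integral>\<^sup>+ x. ?G (t *\<^sub>R x) \<partial>?L) = (\<integral>\<^sup>+ m. F (t *\<^sub>R m) \<partial>orbit_measure)"
    by (subst nn_integral_orbit_measure)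
      (auto intro!: measurable_borel_orbit_measure
        simp: linear_scale[OF linear_skew_of_coords] scaleR_orbit0_iff[OF t] indicator_def)
  finally show ?thesis .
qed

text \<open>In coordinates the set is the intersection of two open sets, by openness of the orbit,
  and it contains the coordinates of m.\<close>

lemma emeasure_orbit_open_pos:
  assumes "open W" "m \<in> W" "m \<in> orbit0"
  shows "emeasure orbit_measure (W \<inter> orbit0) > 0"
proof -
  have [measurable]: "W \<in> sets borel" using assms by simp
  define U where "U = skew_of_coords -` W \<inter> skew_coords ` orbit0"
  have "W \<inter> orbit0 \<in> sets orbit_measure"
    by (auto simp: sets_orbit_measure sets_restrict_space)
  then have "emeasure orbit_measure (W \<inter> orbit0) = (\<integral>\<^sup>+ m. indicator (W \<inter> orbit0) m \<partial>orbit_measure)"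
    by simp
  also have "\<dots> = (\<integral>\<^sup>+ x. indicator U x \<partial>lborel)"
    by (subst nn_integral_orbit_measure)
      (auto intro!: measurable_borel_orbit_measure nn_integral_cong
        simp: U_def indicator_def skew_of_coords_in_orbit0_iff)
  finally have e: "emeasure orbit_measure (W \<inter> orbit0) = (\<integral>\<^sup>+ x. indicator U x \<partial>lborel)" .
  have "open U"
    unfolding U_def using assms
    by (intro open_Int open_vimage open_coords_orbit0 continuous_skew_of_coords)
  moreover have "skew_coords m \<in> U"
    using assms by (simp add: U_def skew_of_coords_coords orbit0_skew)
  ultimately have "emeasure lborel U > 0"
    by (intro emeasure_lborel_open_pos) auto
  then show ?thesis using \<open>open U\<close> by (simp add: e)
qed

lemma emeasure_orbit_bounded_finite:
  assumes A: "A \<in> sets orbit_measure" and b: "bounded A"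
  shows "emeasure orbit_measure A < \<infinity>"
proof -
  have "emeasure orbit_measure A = (\<integral>\<^sup>+ m. indicator A m \<partial>orbit_measure)"
    using A by simp
  also have "\<dots> = (\<integral>\<^sup>+ x. indicator A (skew_of_coords x) * indicator orbit0 (skew_of_coords x) \<partial>lborel)"
    using A by (intro nn_integral_orbit_measure) auto
  \<comment> \<open>Passing to the closure yields a Borel set that is still bounded.\<close>
  also have "\<dots> \<le> (\<integral>\<^sup>+ x. indicator (closure (skew_coords ` A)) x \<partial>lborel)"
  proof (intro nn_integral_mono)
    fix x :: "((real, 'a) vec, 'a) vec"
    have "x \<in> closure (skew_coords ` A)" if "skew_of_coords x \<in> A"
      using that closure_subset[of "skew_coords ` A"] by (metis image_eqI skew_coords_of_coords subsetD)
    then show "indicator A (skew_of_coords x) * indicator orbit0 (skew_of_coords x)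
        \<le> (indicator (closure (skew_coords ` A)) x :: ennreal)"
      by (auto simp: indicator_def)
  qed
  also have "\<dots> = emeasure lborel (closure (skew_coords ` A))"
    by (intro nn_integral_indicator) simp
  also have "\<dots> < \<infinity>"
  proof (rule emeasure_bounded_finite)
    have "bounded (skew_coords ` A)"
      using b linear_skew_coords by (intro bounded_linear_image) (auto simp: linear_linear)
    then show "bounded (closure (skew_coords ` A))" by (rule bounded_closure)
  qed
  finally show ?thesis .
qed

section \<open>The representation\<close>

lemma weight_eq: "weight (m :: 'n::finite cmat) = norm m powr (real ((CARD('n))\<^sup>2) / 2)"
  by (simp add: weight_def matrix_norm_eq)

lemma weight_nonneg [simp]: "weight m \<ge> 0"
  by (simp add: weight_eq)

lemma weight_pos: "m \<in> orbit0 \<Longrightarrow> weight m > 0"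
  using zero_notin_orbit0 by (auto simp: weight_eq)

text \<open>Integrals of squared moduli thereby involve only natural powers of the norm.\<close>

lemma weight_power2:
  assumes "m \<noteq> (0 :: 'n::finite cmat)"
  shows "(weight m)\<^sup>2 = norm m ^ (CARD('n))\<^sup>2"
proof -
  have "(weight m)\<^sup>2 = norm m powr real ((CARD('n))\<^sup>2)"
    unfolding weight_eq power2_eq_square[of "_ powr _"] by (simp add: powr_add[symmetric])
  then show ?thesis using assms by (subst (asm) powr_realpow) auto
qed

lemma measurable_weight [measurable]: "weight \<in> borel_measurable borel"
  unfolding weight_eq[abs_def] by measurable

lemma norm_orbit_act_bound:
  obtains K where "K > 0" "\<And>m. norm (orbit_act s m) \<le> K * norm m"
  using bounded_linear.pos_bounded[OF bounded_linear_orbit_act[of s]] by (metis mult.commute)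

text \<open>Bounds the multiplier of \<open>T_a\<close>: \<open>orbit_act s\<close> is a bounded
  linear map and the weight is a positive power of the norm.\<close>

lemma weight_orbit_act_bound:
  fixes s :: "'n::finite cmat"
  obtains K where "K > 0" "\<And>m. weight (orbit_act s m) \<le> K * weight m"
proof -
  obtain C where C: "C > 0" "\<And>m. norm (orbit_act s m) \<le> C * norm m"
    using norm_orbit_act_bound by metis
  let ?e = "real ((CARD('n))\<^sup>2) / 2"
  show thesis
  proof (rule that)
    show "C powr ?e > 0" using C by simp
    show "weight (orbit_act s m) \<le> C powr ?e * weight m" for m
    proof -
      have "norm (orbit_act s m) powr ?e \<le> (C * norm m) powr ?e"
        using C by (intro powr_mono2) auto
      then show ?thesis using C by (simp add: weight_eq powr_mult)
    qed
  qed
qed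

text \<open>The operator \<open>T_a s \<circ> T_exp n\<close> on functions instead of classes. It
  makes sense without square integrability and can therefore be applied to
  \<open>cutoff\<close>.\<close>

definition act_fun ::
  "'n::{finite,wellorder} cmat \<times> 'n cmat \<Rightarrow> ('n cmat \<Rightarrow> complex) \<Rightarrow> 'n cmat \<Rightarrow> complex" where
  "act_fun g \<phi> m = of_real (weight (orbit_act (fst g) m) / weight m) *
     (exp (\<i> * trace (snd g ** orbit_act (fst g) m)) * \<phi> (orbit_act (fst g) m))"

lemma act_fun_one: "m \<in> orbit0 \<Longrightarrow> act_fun (mat 1, 0) \<phi> m = \<phi> m"
  using weight_pos[of m] by (simp add: act_fun_def trace_def)

text \<open>The weight quotients telescope, as the intermediate weight is nonzero on the orbit, and
  the phases add by \<open>trace_conj_orbit_act\<close>.\<close>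

lemma act_fun_mult:
  assumes g: "g \<in> carrier P_group" and h: "h \<in> carrier P_group" and m: "m \<in> orbit0"
  shows "act_fun (g \<otimes>\<^bsub>P_group\<^esub> h) \<phi> m = act_fun g (act_fun h \<phi>) m"
proof -
  obtain s1 n1 s2 n2 where gh: "g = (s1, n1)" "h = (s2, n2)" "s1 \<in> lower_tri" "s2 \<in> lower_tri"
    using g h by (cases g; cases h) (auto simp: P_group_carrier)
  have pos: "weight (orbit_act s1 m) > 0"
    using weight_pos[OF orbit_act_orbit0[OF gh(3) m]] .
  have tr: "trace ((matrix_inv s2 ** n1 ** ctranspose (matrix_inv s2) + n2) ** orbit_act s2 (orbit_act s1 m))
      = trace (n1 ** orbit_act s1 m) + trace (n2 ** orbit_act s2 (orbit_act s1 m))"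
    by (simp add: matrix_mult_add_rdistrib trace_add trace_conj_orbit_act[OF gh(4)])
  show ?thesis
    unfolding gh P_group_mult[OF gh(4)] act_fun_def fst_conv snd_conv orbit_act_mult tr
    using pos by (simp add: distrib_left exp_add)
qed

lemma act_fun_diff: "act_fun g (\<lambda>m. \<phi> m - \<psi> m) m = act_fun g \<phi> m - act_fun g \<psi> m"
  by (simp add: act_fun_def algebra_simps)

lemma act_fun_add: "act_fun g (\<lambda>m. \<phi> m + \<psi> m) m = act_fun g \<phi> m + act_fun g \<psi> m"
  by (simp add: act_fun_def algebra_simps)

lemma act_fun_cmult: "act_fun g (\<lambda>m. c * \<phi> m) m = c * act_fun g \<phi> m"
  by (simp add: act_fun_def algebra_simps)

lemma measurable_exp_trace [measurable]:
  "(\<lambda>m. exp (\<i> * trace (n ** m))) \<in> borel_measurable orbit_measure"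
proof (intro measurable_borel_orbit_measure borel_measurable_continuous_onI)
  show "continuous_on UNIV (\<lambda>m. exp (\<i> * trace (n ** m)))"
    by (intro continuous_intros linear_continuous_on bounded_linear_trace_mult)
qed

lemma measurable_act_fun:
  assumes "fst g \<in> lower_tri" "\<phi> \<in> borel_measurable orbit_measure"
  shows "act_fun g \<phi> \<in> borel_measurable orbit_measure"
proof -
  note [measurable] = assms(2) measurable_orbit_act[OF assms(1)]
    measurable_borel_orbit_measure[OF measurable_weight]
  show ?thesis unfolding act_fun_def[abs_def] by measurable
qed

lemma norm_exp_trace:
  assumes "n \<in> skew_hermitian" "m \<in> skew_hermitian"
  shows "cmod (exp (\<i> * trace (n ** m))) = 1"
  by (subst trace_mult_skew_real[OF assms]) (rule norm_exp_i_times)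

lemma cmod_act_fun:
  assumes "g \<in> carrier P_group" "m \<in> orbit0"
  shows "cmod (act_fun g \<phi> m) =
    weight (orbit_act (fst g) m) / weight m * cmod (\<phi> (orbit_act (fst g) m))"
proof -
  have "cmod (exp (\<i> * trace (snd g ** orbit_act (fst g) m))) = 1"
    using assms orbit_act_skew[OF orbit0_skew[OF assms(2)]]
    by (intro norm_exp_trace) (auto simp: P_group_carrier)
  then show ?thesis
    by (simp add: act_fun_def norm_mult norm_divide del: norm_exp_eq_Re)
qed

text \<open>The multiplier contributes the square of its bound, the substitution the constant of
  \<open>nn_integral_orbit_act\<close>. With possibly infinite integrals the estimate serves both
  for square integrability and for the operator bound.\<close>

lemma nn_integral_act_fun_le:
  assumes g: "g \<in> carrier P_group"
  obtains C :: real where "C \<ge> 0"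
    "\<And>\<phi>. \<phi> \<in> borel_measurable orbit_measure \<Longrightarrow>
      (\<integral>\<^sup>+ m. ennreal ((cmod (act_fun g \<phi> m))\<^sup>2) \<partial>orbit_measure) \<le>
      ennreal C * (\<integral>\<^sup>+ m. ennreal ((cmod (\<phi> m))\<^sup>2) \<partial>orbit_measure)"
proof -
  have s: "fst g \<in> lower_tri" using g by (auto simp: P_group_carrier)
  obtain K where K: "K > 0" "\<And>m. weight (orbit_act (fst g) m) \<le> K * weight m"
    using weight_orbit_act_bound by metis
  obtain c where c: "c > 0" "\<And>F. F \<in> borel_measurable orbit_measure \<Longrightarrow>
      (\<integral>\<^sup>+ m. F (orbit_act (fst g) m) \<partial>orbit_measure) = ennreal c * (\<integral>\<^sup>+ m. F m \<partial>orbit_measure)"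
    using nn_integral_orbit_act[OF s] by metis
  show thesis
  proof (rule that[of "K\<^sup>2 * c"])
    show "K\<^sup>2 * c \<ge> 0" using c by simp
    fix \<phi> :: "'a cmat \<Rightarrow> complex" assume \<phi> [measurable]: "\<phi> \<in> borel_measurable orbit_measure"
    have "(\<integral>\<^sup>+ m. ennreal ((cmod (act_fun g \<phi> m))\<^sup>2) \<partial>orbit_measure) \<le>
        (\<integral>\<^sup>+ m. ennreal (K\<^sup>2) * ennreal ((cmod (\<phi> (orbit_act (fst g) m)))\<^sup>2) \<partial>orbit_measure)"
    proof (rule nn_integral_mono)
      fix m :: "'a cmat" assume "m \<in> space orbit_measure"
      then have m: "m \<in> orbit0" by simp
      have "weight (orbit_act (fst g) m) / weight m \<le> K"
        using K(2)[of m] weight_pos[OF m] by (simp add: field_simps)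
      then have "cmod (act_fun g \<phi> m) \<le> K * cmod (\<phi> (orbit_act (fst g) m))"
        unfolding cmod_act_fun[OF g m] by (intro mult_right_mono) auto
      then have "(cmod (act_fun g \<phi> m))\<^sup>2 \<le> K\<^sup>2 * (cmod (\<phi> (orbit_act (fst g) m)))\<^sup>2"
        by (metis norm_ge_zero power_mono power_mult_distrib)
      then show "ennreal ((cmod (act_fun g \<phi> m))\<^sup>2) \<le>
          ennreal (K\<^sup>2) * ennreal ((cmod (\<phi> (orbit_act (fst g) m)))\<^sup>2)"
        by (simp add: ennreal_mult[symmetric] ennreal_leI)
    qed
    also have "\<dots> = ennreal (K\<^sup>2) * (\<integral>\<^sup>+ m. ennreal ((cmod (\<phi> (orbit_act (fst g) m)))\<^sup>2) \<partial>orbit_measure)"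
      using measurable_compose[OF measurable_orbit_act[OF s] \<phi>] by (intro nn_integral_cmult) auto
    also have "\<dots> = ennreal (K\<^sup>2) * (ennreal c * (\<integral>\<^sup>+ m. ennreal ((cmod (\<phi> m))\<^sup>2) \<partial>orbit_measure))"
      by (subst c(2)[of "\<lambda>m. ennreal ((cmod (\<phi> m))\<^sup>2)"]) auto
    finally show "(\<integral>\<^sup>+ m. ennreal ((cmod (act_fun g \<phi> m))\<^sup>2) \<partial>orbit_measure) \<le>
        ennreal (K\<^sup>2 * c) * (\<integral>\<^sup>+ m. ennreal ((cmod (\<phi> m))\<^sup>2) \<partial>orbit_measure)"
      using c(1) by (simp add: ennreal_mult mult.assoc)
  qed
qed

text \<open>Quasi-invariance of the measure: preimages of null sets under the action are null.
  Without it \<open>T_a\<close> would depend on the representative.\<close>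

lemma AE_orbit_act:
  assumes s: "s \<in> lower_tri" and P: "AE m in orbit_measure. P m"
  shows "AE m in orbit_measure. P (orbit_act s m)"
proof -
  obtain N where N: "N \<in> null_sets orbit_measure" "{m \<in> space orbit_measure. \<not> P m} \<subseteq> N"
    using P by (auto simp: eventually_ae_filter)
  let ?N = "orbit_act s -` N \<inter> space orbit_measure"
  have [measurable]: "N \<in> sets orbit_measure" using N by auto
  have N': "?N \<in> sets orbit_measure"
    using measurable_orbit_act[OF s] by (rule measurable_sets) measurable
  obtain c where c: "c > (0::real)" "\<And>F. F \<in> borel_measurable orbit_measure \<Longrightarrow>
      (\<integral>\<^sup>+ m. F (orbit_act s m) \<partial>orbit_measure) = ennreal c * (\<integral>\<^sup>+ m. F m \<partial>orbit_measure)"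
    using nn_integral_orbit_act[OF s] by metis
  have "emeasure orbit_measure ?N = (\<integral>\<^sup>+ m. indicator ?N m \<partial>orbit_measure)"
    using N' by simp
  also have "\<dots> = (\<integral>\<^sup>+ m. indicator N (orbit_act s m) \<partial>orbit_measure)"
    by (intro nn_integral_cong) (auto simp: indicator_def)
  also have "\<dots> = ennreal c * (\<integral>\<^sup>+ m. indicator N m \<partial>orbit_measure)"
    by (intro c(2)) auto
  also have "\<dots> = 0" using N by (simp add: null_setsD1)
  finally have "?N \<in> null_sets orbit_measure" using N' by blast
  then show ?thesis
    using N(2) orbit_act_orbit0[OF s] by (intro AE_I'[of ?N]) auto
qed

lemma square_integrable_iff:
  "square_integrable f \<longleftrightarrow> f \<in> borel_measurable orbit_measure \<and>
     (\<integral>\<^sup>+ m. ennreal ((cmod (f m))\<^sup>2) \<partial>orbit_measure) < \<infinity>"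
  unfolding square_integrable_def
  by (auto simp: integrable_iff_bounded)

lemma square_integrable_act_fun:
  assumes g: "g \<in> carrier P_group" and f: "square_integrable f"
  shows "square_integrable (act_fun g f)"
proof -
  have s: "fst g \<in> lower_tri" using g by (auto simp: P_group_carrier)
  obtain C :: real where C: "\<And>\<phi>. \<phi> \<in> borel_measurable orbit_measure \<Longrightarrow>
      (\<integral>\<^sup>+ m. ennreal ((cmod (act_fun g \<phi> m))\<^sup>2) \<partial>orbit_measure) \<le>
      ennreal C * (\<integral>\<^sup>+ m. ennreal ((cmod (\<phi> m))\<^sup>2) \<partial>orbit_measure)"
    using nn_integral_act_fun_le[OF g] by metis
  have "(\<integral>\<^sup>+ m. ennreal ((cmod (act_fun g f m))\<^sup>2) \<partial>orbit_measure) \<le>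
      ennreal C * (\<integral>\<^sup>+ m. ennreal ((cmod (f m))\<^sup>2) \<partial>orbit_measure)"
    using f by (intro C) (simp add: square_integrable_iff)
  also have "\<dots> < \<infinity>"
    using f by (simp add: square_integrable_iff ennreal_mult_less_top)
  finally show ?thesis
    using f measurable_act_fun[OF s] by (simp add: square_integrable_iff)
qed

section \<open>From functions to classes\<close>

lemma abs_orbit_L2_eq_iff:
  assumes "square_integrable f" "square_integrable g"
  shows "abs_orbit_L2 f = abs_orbit_L2 g \<longleftrightarrow> (AE m in orbit_measure. f m = g m)"
  using Quotient_rel[OF Quotient_orbit_L2, of f g] assms by auto

lemma square_integrable_rep: "square_integrable (rep_orbit_L2 F)"
  using Quotient_rep_reflp[OF Quotient_orbit_L2, of F] by auto

lemma abs_rep_orbit_L2: "abs_orbit_L2 (rep_orbit_L2 F) = F"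
  using Quotient_abs_rep[OF Quotient_orbit_L2, of F] .

lemma AE_rep_abs_orbit_L2:
  assumes "square_integrable f"
  shows "AE m in orbit_measure. rep_orbit_L2 (abs_orbit_L2 f) m = f m"
  using Quotient_rep_abs[OF Quotient_orbit_L2, of f] assms by auto

lemma orbit_L2_cases:
  obtains f where "square_integrable f" "F = abs_orbit_L2 f"
  using square_integrable_rep abs_rep_orbit_L2 by metis

lemma norm_abs_orbit_L2:
  assumes "square_integrable f"
  shows "ennreal ((norm (abs_orbit_L2 f))\<^sup>2) = (\<integral>\<^sup>+ m. ennreal ((cmod (f m))\<^sup>2) \<partial>orbit_measure)"
proof -
  have "cinner (abs_orbit_L2 f) (abs_orbit_L2 f) = (\<integral>m. f m * cnj (f m) \<partial>orbit_measure)"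
    by (rule cinner.abs_eq) (use assms in auto)
  also have "\<dots> = of_real (\<integral>m. (cmod (f m))\<^sup>2 \<partial>orbit_measure)"
    by (simp add: complex_norm_square[symmetric] del: of_real_power)
  finally have "(norm (abs_orbit_L2 f))\<^sup>2 = (\<integral>m. (cmod (f m))\<^sup>2 \<partial>orbit_measure)"
    by (simp add: power2_norm_eq_inner inner_orbit_L2_def)
  then show ?thesis
    using assms by (simp add: square_integrable_def nn_integral_eq_integral)
qed

lemma T_exp_abs:
  assumes n: "n \<in> skew_hermitian" and f: "square_integrable f"
  shows "square_integrable (\<lambda>m. exp (\<i> * trace (n ** m)) * f m)"
    "T_exp n (abs_orbit_L2 f) = abs_orbit_L2 (\<lambda>m. exp (\<i> * trace (n ** m)) * f m)"
proof -
  have *: "square_integrable (\<lambda>m. exp (\<i> * trace (n ** m)) * f m)" if f: "square_integrable f" for f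
  proof -
    have [measurable]: "f \<in> borel_measurable orbit_measure"
      using f by (simp add: square_integrable_iff)
    have "(\<integral>\<^sup>+ m. ennreal ((cmod (exp (\<i> * trace (n ** m)) * f m))\<^sup>2) \<partial>orbit_measure) =
        (\<integral>\<^sup>+ m. ennreal ((cmod (f m))\<^sup>2) \<partial>orbit_measure)"
      by (intro nn_integral_cong) (simp add: norm_mult norm_exp_trace[OF n orbit0_skew] del: norm_exp_eq_Re)
    then show ?thesis using f by (simp add: square_integrable_iff)
  qed
  show "square_integrable (\<lambda>m. exp (\<i> * trace (n ** m)) * f m)" by (rule *[OF f])
  show "T_exp n (abs_orbit_L2 f) = abs_orbit_L2 (\<lambda>m. exp (\<i> * trace (n ** m)) * f m)"
    unfolding T_exp_def
    using AE_rep_abs_orbit_L2[OF f] *[OF f] *[OF square_integrable_rep]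
    by (subst abs_orbit_L2_eq_iff) (auto elim: eventually_mono)
qed

text \<open>The chosen representative agrees with f only almost everywhere;
  \<open>AE_orbit_act\<close> carries this agreement through the substitution.\<close>

lemma T_a_abs:
  assumes s: "s \<in> lower_tri" and f: "square_integrable f"
  shows "T_a s (abs_orbit_L2 f) =
    abs_orbit_L2 (\<lambda>m. of_real (weight (orbit_act s m) / weight m) * f (orbit_act s m))"
proof -
  have 0: "trace (0 :: 'a cmat) = 0"
    by (simp add: trace_def)
  have *: "square_integrable (\<lambda>m. of_real (weight (orbit_act s m) / weight m) * f (orbit_act s m))"
    if "square_integrable f" for f
    using square_integrable_act_fun[OF _ that, of "(s, 0)"] s
    by (simp add: act_fun_def[abs_def] P_group_carrier 0 del: of_real_divide)
  show ?thesis
    unfolding T_a_def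
    using AE_orbit_act[OF s AE_rep_abs_orbit_L2[OF f]] *[OF f] *[OF square_integrable_rep]
    by (subst abs_orbit_L2_eq_iff) (auto elim: eventually_mono)
qed

abbreviation rep_op :: "'n::{finite,wellorder} cmat \<times> 'n cmat \<Rightarrow> 'n orbit_L2 \<Rightarrow> 'n orbit_L2" where
  "rep_op \<equiv> \<lambda>(s, n). T_a s \<circ> T_exp n"

lemma rep_op_abs:
  assumes g: "g \<in> carrier P_group" and f: "square_integrable f"
  shows "rep_op g (abs_orbit_L2 f) = abs_orbit_L2 (act_fun g f)"
proof -
  obtain s n where sn: "g = (s, n)" "s \<in> lower_tri" "n \<in> skew_hermitian"
    using g by (cases g) (auto simp: P_group_carrier)
  show ?thesis
    by (simp add: sn T_exp_abs[OF sn(3) f] T_a_abs[OF sn(2) T_exp_abs(1)[OF sn(3) f]] act_fun_def[abs_def])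
qed

lemma abs_orbit_L2_add:
  assumes "square_integrable f" "square_integrable g"
  shows "abs_orbit_L2 f + abs_orbit_L2 g = abs_orbit_L2 (\<lambda>m. f m + g m)"
  by (rule plus_orbit_L2.abs_eq) (use assms in auto)

lemma abs_orbit_L2_scaleC:
  assumes "square_integrable f"
  shows "c *\<^sub>C abs_orbit_L2 f = abs_orbit_L2 (\<lambda>m. c * f m)"
  by (rule scaleC.abs_eq) (use assms in auto)

lemma abs_orbit_L2_uminus:
  assumes "square_integrable f"
  shows "- abs_orbit_L2 f = abs_orbit_L2 (\<lambda>m. - f m)"
  by (rule uminus_orbit_L2.abs_eq) (use assms in auto)

lemma abs_orbit_L2_diff:
  assumes "square_integrable f" "square_integrable g"
  shows "abs_orbit_L2 f - abs_orbit_L2 g = abs_orbit_L2 (\<lambda>m. f m - g m)"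
  using assms by (simp add: minus_orbit_L2_def abs_orbit_L2_uminus abs_orbit_L2_add square_integrable_uminus)

lemma clinear_rep_op:
  fixes g :: "'n::{finite,wellorder} cmat \<times> 'n cmat"
  assumes g: "g \<in> carrier P_group"
  shows "clinear (rep_op g)"
  unfolding clinear_def
proof (intro conjI allI)
  fix F G :: "'n orbit_L2" and c
  obtain f where f: "square_integrable f" "F = abs_orbit_L2 f" by (rule orbit_L2_cases)
  obtain h where h: "square_integrable h" "G = abs_orbit_L2 h" by (rule orbit_L2_cases)
  show "rep_op g (F + G) = rep_op g F + rep_op g G"
    using f h by (simp only: abs_orbit_L2_add rep_op_abs[OF g] square_integrable_add
        square_integrable_act_fun[OF g] act_fun_add[abs_def])
  show "rep_op g (c *\<^sub>C F) = c *\<^sub>C rep_op g F"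
    using f by (simp only: abs_orbit_L2_scaleC rep_op_abs[OF g] square_integrable_cmult
        square_integrable_act_fun[OF g] act_fun_cmult[abs_def])
qed

lemma rep_op_mult:
  fixes g h :: "'n::{finite,wellorder} cmat \<times> 'n cmat"
  assumes g: "g \<in> carrier P_group" and h: "h \<in> carrier P_group"
  shows "rep_op (g \<otimes>\<^bsub>P_group\<^esub> h) = rep_op g \<circ> rep_op h"
proof
  fix F :: "'n orbit_L2"
  have gh: "g \<otimes>\<^bsub>P_group\<^esub> h \<in> carrier P_group"
    by (rule monoid.m_closed[OF group.is_monoid[OF group_P_group] g h])
  obtain f where f: "square_integrable f" "F = abs_orbit_L2 f" by (rule orbit_L2_cases)
  have "abs_orbit_L2 (act_fun (g \<otimes>\<^bsub>P_group\<^esub> h) f) = abs_orbit_L2 (act_fun g (act_fun h f))"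
    using f by (subst abs_orbit_L2_eq_iff)
      (auto intro!: AE_I2 square_integrable_act_fun gh g h simp: act_fun_mult[OF g h])
  then show "rep_op (g \<otimes>\<^bsub>P_group\<^esub> h) F = (rep_op g \<circ> rep_op h) F"
    using f by (simp only: o_apply rep_op_abs[OF g] rep_op_abs[OF h] rep_op_abs[OF gh]
        square_integrable_act_fun[OF g] square_integrable_act_fun[OF h])
qed

lemma rep_op_one: "rep_op \<one>\<^bsub>P_group\<^esub> = (id :: 'n::{finite,wellorder} orbit_L2 \<Rightarrow> _)"
proof
  fix F :: "'n orbit_L2"
  obtain f where f: "square_integrable f" "F = abs_orbit_L2 f" by (rule orbit_L2_cases)
  have 1: "(mat 1, 0) \<in> carrier (P_group :: ('n cmat \<times> 'n cmat) monoid)" by (simp add: P_group_carrier)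
  have "abs_orbit_L2 (act_fun (mat 1, 0) f) = abs_orbit_L2 f"
    using f by (subst abs_orbit_L2_eq_iff)
      (auto intro!: AE_I2 square_integrable_act_fun 1 simp: act_fun_one)
  then show "rep_op \<one>\<^bsub>P_group\<^esub> F = id F"
    using f by (simp only: P_group_one rep_op_abs[OF 1] id_apply)
qed

lemma representation_rep_op: "representation P_group rep_op"
  unfolding representation_def
proof (intro conjI homI group_P_group)
  fix g h :: "'n::{finite,wellorder} cmat \<times> 'n cmat"
  assume g: "g \<in> carrier P_group"
  interpret P: group "P_group :: ('n cmat \<times> 'n cmat) monoid" by (rule group_P_group)
  have i: "inv\<^bsub>P_group\<^esub> g \<in> carrier P_group" using g by simp
  have "rep_op g \<circ> rep_op (inv\<^bsub>P_group\<^esub> g) = id" "rep_op (inv\<^bsub>P_group\<^esub> g) \<circ> rep_op g = id"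
    using g i by (simp_all only: rep_op_mult[symmetric] P.r_inv P.l_inv rep_op_one)
  then have "bij (rep_op g)" using o_bij by blast
  then show "rep_op g \<in> carrier GL_group"
    using clinear_rep_op[OF g] by (simp add: GL_group_def)
  assume h: "h \<in> carrier P_group"
  show "rep_op (g \<otimes>\<^bsub>P_group\<^esub> h) = rep_op g \<otimes>\<^bsub>GL_group\<^esub> rep_op h"
    using rep_op_mult[OF g h] by (simp add: GL_group_def)
qed

lemma bounded_rep_op: "bounded_rep P_group rep_op"
  unfolding bounded_rep_def
proof
  fix g :: "'n::{finite,wellorder} cmat \<times> 'n cmat"
  assume g: "g \<in> carrier P_group"
  obtain C :: real where C: "C \<ge> 0" "\<And>\<phi>. \<phi> \<in> borel_measurable orbit_measure \<Longrightarrow>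
      (\<integral>\<^sup>+ m. ennreal ((cmod (act_fun g \<phi> m))\<^sup>2) \<partial>orbit_measure) \<le>
      ennreal C * (\<integral>\<^sup>+ m. ennreal ((cmod (\<phi> m))\<^sup>2) \<partial>orbit_measure)"
    using nn_integral_act_fun_le[OF g] by metis
  show "bounded_linear (rep_op g)"
  proof (rule bounded_linear_intro)
    fix F G :: "'n orbit_L2" and r :: real
    show "rep_op g (F + G) = rep_op g F + rep_op g G"
      using clinear_rep_op[OF g] unfolding clinear_def by blast
    show "rep_op g (r *\<^sub>R F) = r *\<^sub>R rep_op g F"
      using clinear_rep_op[OF g] unfolding clinear_def scaleR_orbit_L2_def by blast
    obtain f where f: "square_integrable f" "F = abs_orbit_L2 f" by (rule orbit_L2_cases)
    have "ennreal ((norm (rep_op g F))\<^sup>2) \<le> ennreal (C * (norm F)\<^sup>2)"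
      using C(2)[of f] f(1) C(1) unfolding f(2) rep_op_abs[OF g f(1)]
      by (simp add: norm_abs_orbit_L2 square_integrable_act_fun[OF g] ennreal_mult)
        (simp add: square_integrable_def)
    then have "(norm (rep_op g F))\<^sup>2 \<le> (norm F * sqrt C)\<^sup>2"
      using C(1) by (simp add: power_mult_distrib mult.commute)
    then show "norm (rep_op g F) \<le> norm F * sqrt C"
      using C(1) by (rule_tac power2_le_imp_le) auto
  qed
qed

section \<open>The cocycle\<close>

text \<open>The indicator of the unit ball carried back to L2(dm): dividing by \<open>weight\<close>
  turns the density \<open>norm m\<close> to the power -p^2 into dm.\<close>

definition cutoff :: "'n::finite cmat \<Rightarrow> complex" where
  "cutoff m = of_real ((if norm m \<le> 1 then 1 else 0) / weight m)"

lemma measurable_cutoff: "cutoff \<in> borel_measurable orbit_measure"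
  unfolding cutoff_def[abs_def] by (intro measurable_borel_orbit_measure) measurable

lemma Int_orbit0_sets:
  assumes "A \<in> sets borel"
  shows "A \<inter> orbit0 \<in> sets orbit_measure"
  unfolding sets_orbit_measure sets_restrict_space using assms by (simp add: image_iff Int_commute) blast

lemma cmod_exp_i_minus_1_le: "cmod (exp (\<i> * of_real t) - 1) \<le> \<bar>t\<bar>"
  using abs_sin_x_le_abs_x[of "t / 2"] by (simp add: dist_exp_i_1)

text \<open>Far out both indicators vanish. Near the origin both are 1 and only the phase differs
  from 1, by a multiple of \<open>norm m\<close>. In the shell between, the trivial bound 2 is
  itself at most a multiple of \<open>norm m\<close>.\<close>

lemma cutoff_coboundary_bound:
  fixes g :: "'n::{finite,wellorder} cmat \<times> 'n cmat"
  assumes g: "g \<in> carrier P_group"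
  obtains C R where "C \<ge> 0" "R > 0"
    "\<And>m. m \<in> orbit0 \<Longrightarrow>
      cmod (act_fun g cutoff m - cutoff m) \<le> C * (if norm m \<le> R then norm m / weight m else 0)"
proof -
  obtain s n where sn: "g = (s, n)" "s \<in> lower_tri" "n \<in> skew_hermitian"
    using g by (cases g) (auto simp: P_group_carrier)
  obtain K where K: "K > 0" "\<And>m. norm (orbit_act s m) \<le> K * norm m"
    using norm_orbit_act_bound by metis
  obtain K' where K': "K' > 0" "\<And>m. norm (orbit_act (matrix_inv s) m) \<le> K' * norm m"
    using norm_orbit_act_bound by metis
  have K'_inv: "norm m \<le> K' * norm (orbit_act s m)" for m
    using K'(2)[of "orbit_act s m"] by (simp add: orbit_act_inv[OF sn(2)])
  obtain T where T: "T > 0" "\<And>m. cmod (trace (n ** m)) \<le> norm m * T"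
    using bounded_linear.pos_bounded[OF bounded_linear_trace_mult[of n]] by blast
  \<comment> \<open>Up to \<open>\<delta>\<close> both m and its image lie in the unit ball; beyond
    R both lie outside it. C adds the constants of the two inner zones, T K for the phase and
    \<open>2 / \<delta>\<close> for the shell.\<close>
  define \<delta> where "\<delta> = min 1 (1 / K)"
  define R where "R = max 1 K'"
  define C where "C = T * K + 2 / \<delta>"
  have \<delta>: "\<delta> > 0" "\<delta> \<le> 1" "\<delta> * K \<le> 1" using K by (auto simp: \<delta>_def min_def field_simps)
  show thesis
  proof (rule that[of C R])
    show C: "C \<ge> 0" using \<delta> T K by (simp add: C_def)
    show R: "R > 0" by (simp add: R_def)
    fix m :: "'n cmat" assume m: "m \<in> orbit0"
    define m' where "m' = orbit_act s m"
    have m': "m' \<in> orbit0" using orbit_act_orbit0[OF sn(2) m] by (simp add: m'_def)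
    define t where "t = Re (trace (n ** m'))"
    have tr: "trace (n ** m') = of_real t"
      unfolding t_def by (rule trace_mult_skew_real[OF sn(3) orbit0_skew[OF m']])
    define \<iota> :: "'n cmat \<Rightarrow> real" where "\<iota> = (\<lambda>m. if norm m \<le> 1 then 1 else 0)"
    have w: "weight m > 0" "weight m' > 0" using weight_pos m m' by auto
    \<comment> \<open>The numerator of the multiplier cancels the weight hidden in
      \<open>cutoff m'\<close>, so both terms share the denominator \<open>weight m\<close>.\<close>
    have eq: "act_fun g cutoff m - cutoff m = (exp (\<i> * of_real t) * of_real (\<iota> m') - of_real (\<iota> m)) / of_real (weight m)"
      using w by (simp add: act_fun_def sn cutoff_def tr \<iota>_def flip: m'_def) (simp add: field_simps)
    have main: "cmod (exp (\<i> * of_real t) * of_real (\<iota> m') - of_real (\<iota> m)) \<le>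
        C * (if norm m \<le> R then norm m else 0)"
    proof -
      consider "norm m > R" | "norm m \<le> \<delta>" | "norm m > \<delta>" "norm m \<le> R" by linarith
      then show ?thesis
      proof cases
        case 1
        then have "norm m > K'" "norm m > 1" by (auto simp: R_def)
        then have "norm m' > 1"
          using K'_inv[of m] K'(1) unfolding m'_def[symmetric]
          by (smt (verit, best) mult_le_cancel_left2)
        then show ?thesis using 1 \<open>norm m > 1\<close> by (simp add: \<iota>_def)
      next
        case 2
        have "norm m' \<le> K * norm m" using K by (simp add: m'_def)
        also have "\<dots> \<le> K * \<delta>" using 2 K by (intro mult_left_mono) auto
        finally have "norm m' \<le> 1" using \<delta> by (simp add: mult.commute)
        moreover have "norm m \<le> 1" "norm m \<le> R" using 2 \<delta> by (auto simp: R_def)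
        moreover have "cmod (exp (\<i> * of_real t) - 1) \<le> C * norm m"
        proof -
          have "cmod (exp (\<i> * of_real t) - 1) \<le> \<bar>t\<bar>" by (rule cmod_exp_i_minus_1_le)
          also have "\<dots> \<le> T * norm m'" using T(2)[of m'] by (simp add: tr mult.commute)
          also have "\<dots> \<le> T * (K * norm m)"
            using T K by (intro mult_left_mono) (auto simp: m'_def)
          also have "\<dots> \<le> C * norm m"
            using \<delta> by (simp add: C_def distrib_right mult.assoc)
          finally show ?thesis .
        qed
        ultimately show ?thesis by (simp add: \<iota>_def)
      next
        case 3
        have "cmod (exp (\<i> * of_real t) * of_real (\<iota> m') - of_real (\<iota> m)) \<le>
            cmod (exp (\<i> * of_real t) * of_real (\<iota> m')) + cmod (of_real (\<iota> m))"
          by (rule norm_triangle_ineq4)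
        also have "\<dots> \<le> 2" by (simp add: norm_mult \<iota>_def)
        also have "\<dots> \<le> (2 / \<delta>) * norm m" using 3 \<delta> by (simp add: field_simps)
        also have "\<dots> \<le> C * norm m" using T K by (simp add: C_def distrib_right)
        finally show ?thesis using 3 by simp
      qed
    qed
    have "cmod (act_fun g cutoff m - cutoff m) \<le> C * (if norm m \<le> R then norm m else 0) / weight m"
      unfolding eq norm_divide using main w by (simp add: divide_right_mono)
    then show "cmod (act_fun g cutoff m - cutoff m) \<le> C * (if norm m \<le> R then norm m / weight m else 0)"
      by (auto split: if_splits)
  qed
qed

text \<open>Dyadic shells: the integrand has degree 2 - p^2 and the measure degree p^2, so the shell
  shrunk by 2^k carries 4^(-k) times the integral over the outermost one, and the geometric series
  converges. F is the integrand on that outermost shell.\<close>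

lemma nn_integral_orbit_norm_power_finite:
  fixes R :: real
  assumes R: "R > 0"
  shows "(\<integral>\<^sup>+ m. ennreal (if norm m \<le> R then (norm m)\<^sup>2 / norm m ^ (CARD('n))\<^sup>2 else 0)
    \<partial>(orbit_measure :: 'n::{finite,wellorder} cmat measure)) < \<infinity>"
proof -
  define d where "d = (CARD('n))\<^sup>2"
  let ?M = "orbit_measure :: 'n cmat measure"
  define f where "f = (\<lambda>m :: 'n cmat. (norm m)\<^sup>2 / norm m ^ d)"
  define F where "F = (\<lambda>m :: 'n cmat. ennreal (if R / 2 < norm m \<and> norm m \<le> R then f m else 0))"
  have F [measurable]: "F \<in> borel_measurable borel" unfolding F_def f_def by measurable
  have f_nonneg: "f m \<ge> 0" for m by (simp add: f_def)
  have f_scale: "f (2 ^ k *\<^sub>R m) = (4 ^ k / (2 ^ k) ^ d) * f m" for k m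
  proof -
    have "(2 ^ k)\<^sup>2 = (4 ^ k :: real)"
      by (simp add: power2_eq_square flip: power_mult_distrib)
    then show ?thesis by (simp add: f_def power_mult_distrib)
  qed
  have step: "(\<integral>\<^sup>+ m. ennreal ((2 ^ k) ^ d / 4 ^ k) * F (2 ^ k *\<^sub>R m) \<partial>?M) =
      ennreal ((1 / 4) ^ k) * (\<integral>\<^sup>+ m. F m \<partial>?M)" for k
  proof -
    have [measurable]: "(\<lambda>m. F (2 ^ k *\<^sub>R m)) \<in> borel_measurable ?M"
      by (intro measurable_borel_orbit_measure) measurable
    have "(\<integral>\<^sup>+ m. ennreal ((2 ^ k) ^ d / 4 ^ k) * F (2 ^ k *\<^sub>R m) \<partial>?M) =
        ennreal ((2 ^ k) ^ d / 4 ^ k) * (\<integral>\<^sup>+ m. F (2 ^ k *\<^sub>R m) \<partial>?M)"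
      by (rule nn_integral_cmult) measurable
    also have "\<dots> = ennreal ((1 / 4) ^ k) * (ennreal ((2 ^ k) ^ d) * (\<integral>\<^sup>+ m. F (2 ^ k *\<^sub>R m) \<partial>?M))"
      by (simp add: mult.assoc[symmetric] ennreal_mult[symmetric] power_divide)
    also have "\<dots> = ennreal ((1 / 4) ^ k) * (\<integral>\<^sup>+ m. F m \<partial>?M)"
      by (subst nn_integral_orbit_scaleR[OF F, of "2 ^ k"]) (simp_all add: d_def)
    finally show ?thesis .
  qed
  \<comment> \<open>Some dilate of m by a power of 2 falls into the outermost shell, and the
    corresponding term of the series alone equals the left-hand side.\<close>
  have ptw: "ennreal (if norm m \<le> R then f m else 0) \<le>
      (\<Sum>k. ennreal ((2 ^ k) ^ d / 4 ^ k) * F (2 ^ k *\<^sub>R m))" if m: "m \<in> orbit0" for m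
  proof (cases "norm m \<le> R")
    case True
    have nm: "norm m > 0" using m zero_notin_orbit0 by auto
    obtain n where "R / 2 / norm m < 2 ^ n"
      using real_arch_pow[of 2 "R / 2 / norm m"] by auto
    then have ex: "R / 2 < 2 ^ n * norm m" using nm by (simp add: field_simps)
    \<comment> \<open>Minimality gives the upper bound: the preceding dilate has norm at most R / 2,
      so doubling stays within R. For k = 0 the bound is \<open>norm m \<le> R\<close>
      itself.\<close>
    define k where "k = (LEAST n. R / 2 < 2 ^ n * norm m)"
    have k: "R / 2 < 2 ^ k * norm m" unfolding k_def using ex by (rule LeastI)
    have "2 ^ k * norm m \<le> R"
    proof (cases k)
      case (Suc j)
      then have "\<not> R / 2 < 2 ^ j * norm m"
        using not_less_Least[of j "\<lambda>n. R / 2 < 2 ^ n * norm m"] by (simp add: k_def)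
      then show ?thesis using Suc by simp
    qed (use True in simp)
    then have "F (2 ^ k *\<^sub>R m) = ennreal (f (2 ^ k *\<^sub>R m))"
      using k by (simp add: F_def)
    then have "ennreal ((2 ^ k) ^ d / 4 ^ k) * F (2 ^ k *\<^sub>R m) = ennreal (f m)"
      by (simp add: f_scale ennreal_mult[symmetric] f_nonneg)
    moreover have "ennreal ((2 ^ k) ^ d / 4 ^ k) * F (2 ^ k *\<^sub>R m) \<le>
        (\<Sum>k. ennreal ((2 ^ k) ^ d / 4 ^ k) * F (2 ^ k *\<^sub>R m))"
      using sum_le_suminf[of "\<lambda>k. ennreal ((2 ^ k) ^ d / 4 ^ k) * F (2 ^ k *\<^sub>R m)" "{k}"] by simp
    ultimately show ?thesis using True by simp
  qed simp
  have finF: "(\<integral>\<^sup>+ m. F m \<partial>?M) < \<infinity>"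
  proof -
    define A where "A = cball (0 :: 'n cmat) R \<inter> orbit0"
    have A: "A \<in> sets ?M" "bounded A"
      unfolding A_def by (auto intro: Int_orbit0_sets bounded_subset[OF bounded_cball])
    define B where "B = R\<^sup>2 / (R / 2) ^ d"
    have "(\<integral>\<^sup>+ m. F m \<partial>?M) \<le> (\<integral>\<^sup>+ m. ennreal B * indicator A m \<partial>?M)"
    proof (rule nn_integral_mono)
      fix m assume "m \<in> space ?M"
      moreover have "f m \<le> B" if "R / 2 < norm m" "norm m \<le> R"
        unfolding f_def B_def using that R by (intro frac_le power_mono) auto
      ultimately show "F m \<le> ennreal B * indicator A m"
        by (auto simp: F_def A_def indicator_def intro!: ennreal_leI)
    qed
    also have "\<dots> = ennreal B * emeasure ?M A" using A by (simp add: nn_integral_cmult)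
    also have "\<dots> < \<infinity>"
      using emeasure_orbit_bounded_finite[OF A] by (simp add: ennreal_mult_less_top)
    finally show ?thesis .
  qed
  have "(\<integral>\<^sup>+ m. ennreal (if norm m \<le> R then f m else 0) \<partial>?M) \<le>
      (\<integral>\<^sup>+ m. (\<Sum>k. ennreal ((2 ^ k) ^ d / 4 ^ k) * F (2 ^ k *\<^sub>R m)) \<partial>?M)"
    by (intro nn_integral_mono ptw) simp
  also have "\<dots> = (\<Sum>k. \<integral>\<^sup>+ m. ennreal ((2 ^ k) ^ d / 4 ^ k) * F (2 ^ k *\<^sub>R m) \<partial>?M)"
    by (rule nn_integral_suminf) (intro measurable_borel_orbit_measure, measurable)
  also have "\<dots> = (\<Sum>k. ennreal ((1 / 4) ^ k)) * (\<integral>\<^sup>+ m. F m \<partial>?M)"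
    unfolding step by (rule ennreal_suminf_multc)
  also have "(\<Sum>k. ennreal ((1 / 4) ^ k)) = ennreal (\<Sum>k. (1 / 4) ^ k)"
    by (rule suminf_ennreal2) (auto intro: summable_geometric)
  also have "ennreal (\<Sum>k. (1 / 4) ^ k) * (\<integral>\<^sup>+ m. F m \<partial>?M) < \<infinity>"
    using finF by (simp add: ennreal_mult_less_top)
  finally show ?thesis unfolding f_def d_def .
qed

lemma square_integrable_cutoff_coboundary:
  fixes g :: "'n::{finite,wellorder} cmat \<times> 'n cmat"
  assumes g: "g \<in> carrier P_group"
  shows "square_integrable (\<lambda>m. act_fun g cutoff m - cutoff m)"
  unfolding square_integrable_iff
proof
  have s: "fst g \<in> lower_tri" using g by (auto simp: P_group_carrier)
  show "(\<lambda>m. act_fun g cutoff m - cutoff m) \<in> borel_measurable orbit_measure"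
    by (intro borel_measurable_diff measurable_act_fun[OF s] measurable_cutoff)
  obtain C R where CR: "C \<ge> 0" "R > 0" "\<And>m. m \<in> orbit0 \<Longrightarrow>
      cmod (act_fun g cutoff m - cutoff m) \<le> C * (if norm m \<le> R then norm m / weight m else 0)"
    using cutoff_coboundary_bound[OF g] by metis
  let ?h = "\<lambda>m :: 'n cmat. if norm m \<le> R then (norm m)\<^sup>2 / norm m ^ (CARD('n))\<^sup>2 else 0"
  have [measurable]: "(\<lambda>m. ennreal (?h m)) \<in> borel_measurable orbit_measure"
    by (intro measurable_borel_orbit_measure) measurable
  have "(\<integral>\<^sup>+ m. ennreal ((cmod (act_fun g cutoff m - cutoff m))\<^sup>2) \<partial>orbit_measure) \<le>
      (\<integral>\<^sup>+ m. ennreal (C\<^sup>2) * ennreal (?h m) \<partial>orbit_measure)"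
  proof (rule nn_integral_mono)
    fix m :: "'n cmat" assume "m \<in> space orbit_measure"
    then have m: "m \<in> orbit0" by simp
    then have "m \<noteq> 0" using zero_notin_orbit0 by auto
    have "(cmod (act_fun g cutoff m - cutoff m))\<^sup>2 \<le>
        (C * (if norm m \<le> R then norm m / weight m else 0))\<^sup>2"
      using CR(3)[OF m] by (intro power_mono) auto
    also have "\<dots> = C\<^sup>2 * ?h m"
      by (simp add: power_mult_distrib power_divide weight_power2[OF \<open>m \<noteq> 0\<close>])
    finally show "ennreal ((cmod (act_fun g cutoff m - cutoff m))\<^sup>2) \<le> ennreal (C\<^sup>2) * ennreal (?h m)"
      by (simp add: ennreal_mult[symmetric] ennreal_leI)
  qed
  also have "\<dots> = ennreal (C\<^sup>2) * (\<integral>\<^sup>+ m. ennreal (?h m) \<partial>orbit_measure)"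
    by (rule nn_integral_cmult) measurable
  also have "\<dots> < \<infinity>"
    using nn_integral_orbit_norm_power_finite[where 'n = 'n, OF CR(2)] by (simp add: ennreal_mult_less_top)
  finally show "(\<integral>\<^sup>+ m. ennreal ((cmod (act_fun g cutoff m - cutoff m))\<^sup>2) \<partial>orbit_measure) < \<infinity>" .
qed

lemma orbit0_nonempty: "gram (mat 1) \<in> orbit0"
  by (simp add: orbit0_eq_gram)

text \<open>
  The squared modulus of the cutoff is homogeneous of degree \<open>-p\<^sup>2\<close> on the unit ball, so dilation
  by \<open>2\<close> shows that the half ball carries the whole integral. Were it finite, the shell between the
  two balls would contribute \<open>0\<close>.
\<close>

lemma not_square_integrable_cutoff:
  "\<not> square_integrable (cutoff :: 'n::{finite,wellorder} cmat \<Rightarrow> complex)"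
proof
  let ?M = "orbit_measure :: 'n cmat measure"
  define d where "d = (CARD('n))\<^sup>2"
  define F where "F = (\<lambda>m :: 'n cmat. ennreal (if norm m \<le> 1 then 1 / norm m ^ d else 0))"
  define H where "H = (\<lambda>m :: 'n cmat. ennreal (if norm m \<le> 1 / 2 then 1 / norm m ^ d else 0))"
  define S where "S = (\<lambda>m :: 'n cmat. ennreal (if norm m \<le> 1 \<and> \<not> norm m \<le> 1 / 2 then 1 / norm m ^ d else 0))"
  have F [measurable]: "F \<in> borel_measurable borel" unfolding F_def by measurable
  have H [measurable]: "H \<in> borel_measurable borel" unfolding H_def by measurable
  have S [measurable]: "S \<in> borel_measurable borel" unfolding S_def by measurable
  assume "square_integrable (cutoff :: 'n cmat \<Rightarrow> complex)"
  then have "(\<integral>\<^sup>+ m. ennreal ((cmod (cutoff m))\<^sup>2) \<partial>?M) < \<infinity>"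
    by (simp add: square_integrable_iff)
  also have "(\<integral>\<^sup>+ m. ennreal ((cmod (cutoff m))\<^sup>2) \<partial>?M) = (\<integral>\<^sup>+ m. F m \<partial>?M)"
  proof (rule nn_integral_cong)
    fix m assume "m \<in> space ?M"
    then have "m \<noteq> 0" using zero_notin_orbit0 by auto
    then show "ennreal ((cmod (cutoff m))\<^sup>2) = F m"
      by (simp add: cutoff_def F_def norm_divide power_divide weight_power2 d_def)
  qed
  finally have fin: "(\<integral>\<^sup>+ m. F m \<partial>?M) < \<infinity>" .
  have [measurable]: "F \<in> borel_measurable ?M" "H \<in> borel_measurable ?M" "S \<in> borel_measurable ?M"
    by (auto intro: measurable_borel_orbit_measure F H S)
  have FH: "(\<integral>\<^sup>+ m. F m \<partial>?M) = (\<integral>\<^sup>+ m. H m \<partial>?M)"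
  proof -
    have "(\<integral>\<^sup>+ m. F m \<partial>?M) = ennreal (2 ^ d) * (\<integral>\<^sup>+ m. F (2 *\<^sub>R m) \<partial>?M)"
      unfolding d_def by (rule nn_integral_orbit_scaleR[OF F]) simp
    also have "\<dots> = (\<integral>\<^sup>+ m. ennreal (2 ^ d) * F (2 *\<^sub>R m) \<partial>?M)"
      by (rule nn_integral_cmult[symmetric]) (intro measurable_borel_orbit_measure, measurable)
    also have "\<dots> = (\<integral>\<^sup>+ m. H m \<partial>?M)"
      by (rule nn_integral_cong) (auto simp: F_def H_def ennreal_mult[symmetric] power_mult_distrib)
    finally show ?thesis .
  qed
  have "(\<integral>\<^sup>+ m. F m \<partial>?M) = (\<integral>\<^sup>+ m. H m + S m \<partial>?M)"
    by (rule nn_integral_cong) (auto simp: F_def H_def S_def)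
  also have "\<dots> = (\<integral>\<^sup>+ m. H m \<partial>?M) + (\<integral>\<^sup>+ m. S m \<partial>?M)"
    by (rule nn_integral_add) measurable
  finally have S0: "(\<integral>\<^sup>+ m. S m \<partial>?M) = 0"
    using fin FH by (metis add.right_neutral ennreal_add_left_cancel infinity_ennreal_def less_irrefl)
  define W where "W = {m :: 'n cmat. 1 / 2 < norm m \<and> norm m < 1}"
  have W: "open W" unfolding W_def by (intro open_Collect_conj open_Collect_less continuous_intros)
  have W_sets: "W \<inter> orbit0 \<in> sets ?M"
    using W by (intro Int_orbit0_sets borel_open)
  \<comment> \<open>The base point rescaled to norm 3/4, inside the open shell.\<close>
  define m0 :: "'n cmat" where "m0 = (3 / 4 / norm (gram (mat 1 :: 'n cmat))) *\<^sub>R gram (mat 1)"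
  have g0: "norm (gram (mat 1 :: 'n cmat)) > 0"
    using orbit0_nonempty zero_notin_orbit0 by (metis zero_less_norm_iff)
  have "m0 \<in> orbit0" unfolding m0_def using g0 by (intro scaleR_orbit0 orbit0_nonempty) simp
  moreover have "m0 \<in> W" using g0 by (simp add: m0_def W_def)
  ultimately have "0 < emeasure ?M (W \<inter> orbit0)"
    using W by (intro emeasure_orbit_open_pos)
  also have "emeasure ?M (W \<inter> orbit0) = (\<integral>\<^sup>+ m. indicator (W \<inter> orbit0) m \<partial>?M)"
    using W_sets by simp
  also have "\<dots> \<le> (\<integral>\<^sup>+ m. S m \<partial>?M)"
  proof (rule nn_integral_mono)
    fix m :: "'n cmat"
    have "1 \<le> 1 / norm m ^ d" if "m \<in> W"
    proof -
      have "0 < norm m" "norm m \<le> 1" using that by (auto simp: W_def)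
      then have "0 < norm m ^ d" "norm m ^ d \<le> 1" by (simp_all add: power_le_one)
      then show ?thesis by simp
    qed
    then show "indicator (W \<inter> orbit0) m \<le> S m"
      by (auto simp: S_def W_def indicator_def)
  qed
  finally show False using S0 by simp
qed

text \<open>
  A primitive \<open>f\<close> of the cocycle would differ from the cutoff by a function invariant under \<open>N\<close>.
  At \<open>m = i s\<^sup>* s\<close> the elements \<open>(i / k) 1\<close> of \<open>N\<close> act on such a function by \<open>exp (- i Tr (s\<^sup>* s) / k)\<close>,
  which is not \<open>1\<close> for large \<open>k\<close>.
\<close>

lemma special_rep_op: "special_rep P_group (rep_op :: _ \<Rightarrow> 'n::{finite,wellorder} orbit_L2 \<Rightarrow> _)"
  unfolding special_rep_def
proof (intro exI conjI)
  define \<beta> where "\<beta> = (\<lambda>g :: 'n cmat \<times> 'n cmat. abs_orbit_L2 (\<lambda>m. act_fun g cutoff m - cutoff m))"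
  show "cocycle P_group rep_op \<beta>"
    unfolding cocycle_def
  proof (intro ballI)
    fix g h :: "'n cmat \<times> 'n cmat"
    assume g: "g \<in> carrier P_group" and h: "h \<in> carrier P_group"
    have gh: "g \<otimes>\<^bsub>P_group\<^esub> h \<in> carrier P_group"
      by (rule monoid.m_closed[OF group.is_monoid[OF group_P_group] g h])
    \<comment> \<open>As a formal coboundary the cocycle identity telescopes; square integrability
      of the pieces is what allows it to be read in the space of classes.\<close>
    note sq = square_integrable_cutoff_coboundary
    note sq_sum = square_integrable_add[OF sq[OF g] square_integrable_act_fun[OF g sq[OF h]]]
    have "\<beta> g + rep_op g (\<beta> h) =
        abs_orbit_L2 (\<lambda>m. act_fun g cutoff m - cutoff m + act_fun g (\<lambda>m. act_fun h cutoff m - cutoff m) m)"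
      unfolding \<beta>_def rep_op_abs[OF g sq[OF h]]
      by (rule abs_orbit_L2_add[OF sq[OF g] square_integrable_act_fun[OF g sq[OF h]]])
    also have "\<dots> = \<beta> (g \<otimes>\<^bsub>P_group\<^esub> h)"
      unfolding \<beta>_def abs_orbit_L2_eq_iff[OF sq_sum sq[OF gh]]
      by (rule AE_I2) (simp add: act_fun_mult[OF g h] act_fun_diff)
    finally show "\<beta> (g \<otimes>\<^bsub>P_group\<^esub> h) = \<beta> g + rep_op g (\<beta> h)" ..
  qed
  show "\<not> coboundary P_group rep_op \<beta>"
  proof
    assume "coboundary P_group rep_op \<beta>"
    then obtain F where F: "\<And>g. g \<in> carrier P_group \<Longrightarrow> \<beta> g = rep_op g F - F"
      unfolding coboundary_def by blast
    obtain f where f: "square_integrable f" "F = abs_orbit_L2 f" by (rule orbit_L2_cases)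
    define n :: "nat \<Rightarrow> 'n cmat" where "n = (\<lambda>k. mat (\<i> / of_nat (Suc k)))"
    have n_skew: "n k \<in> skew_hermitian" for k
      by (auto simp: n_def skew_hermitian_def vec_eq_iff mat_def)
    have g: "(mat 1, n k) \<in> carrier P_group" for k
      using n_skew by (simp add: P_group_carrier)
    have "AE m in orbit_measure. act_fun (mat 1, n k) cutoff m - cutoff m = act_fun (mat 1, n k) f m - f m" for k
    proof -
      have "abs_orbit_L2 (\<lambda>m. act_fun (mat 1, n k) cutoff m - cutoff m) =
          abs_orbit_L2 (\<lambda>m. act_fun (mat 1, n k) f m - f m)"
        using F[OF g[of k]] f(1) unfolding \<beta>_def f(2) rep_op_abs[OF g f(1)]
        by (simp add: abs_orbit_L2_diff square_integrable_act_fun[OF g])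
      then show ?thesis
        using square_integrable_act_fun[OF g f(1)] f(1) square_integrable_cutoff_coboundary[OF g]
        by (subst (asm) abs_orbit_L2_eq_iff)
          (auto intro: square_integrable_add[OF _ square_integrable_uminus, simplified])
    qed
    \<comment> \<open>A sequence in N suffices, and countability keeps the union of the exceptional
      sets null while the index k may afterwards depend on m.\<close>
    then have "AE m in orbit_measure. \<forall>k. act_fun (mat 1, n k) cutoff m - cutoff m = act_fun (mat 1, n k) f m - f m"
      by (simp add: AE_all_countable)
    then have "AE m in orbit_measure. cutoff m = f m"
    proof (rule AE_mp, intro AE_I2 impI)
      fix m :: "'n cmat" assume "m \<in> space orbit_measure"
      then have m: "m \<in> orbit0" by simp
      assume all: "\<forall>k. act_fun (mat 1, n k) cutoff m - cutoff m = act_fun (mat 1, n k) f m - f m"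
      obtain s where s: "s \<in> lower_tri" "m = gram s" using m by (auto simp: orbit0_eq_gram)
      define \<tau> where "\<tau> = (\<Sum>i\<in>UNIV. \<Sum>k\<in>UNIV. (cmod (s $ k $ i))\<^sup>2)"
      have "trace m = \<i> * of_real \<tau>"
        by (simp add: s trace_def gram_nth \<tau>_def sum_distrib_left mult.commute[of "cnj _"]
            complex_norm_square del: of_real_power)
      moreover have "trace (n k ** m) = \<i> / of_nat (Suc k) * trace m" for k
      proof -
        have "(n k ** m) $ i $ j = \<i> / of_nat (Suc k) * m $ i $ j" for i j
          by (simp add: matrix_matrix_mult_def n_def mat_def if_distrib[of "\<lambda>x. x * _"] cong: if_cong)
        then show ?thesis by (simp add: trace_def sum_distrib_left)
      qed
      ultimately have tr: "\<i> * trace (n k ** m) = \<i> * of_real (- \<tau> / real (Suc k))" for k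
        by (simp add: field_simps)
      have "\<tau> > 0"
      proof -
        fix i0 :: 'n
        have "0 < (cmod (s $ i0 $ i0))\<^sup>2" using lower_triD(4)[OF s(1)] by simp
        also have "\<dots> \<le> (\<Sum>k\<in>UNIV. (cmod (s $ k $ i0))\<^sup>2)" by (rule member_le_sum) auto
        also have "\<dots> \<le> \<tau>"
          unfolding \<tau>_def by (rule member_le_sum) (auto intro: sum_nonneg)
        finally show ?thesis .
      qed
      \<comment> \<open>This places the phase strictly between -1 and 0, where the sine is
        negative.\<close>
      obtain k where k: "\<tau> < real (Suc k)" using reals_Archimedean2 by (metis lessI less_trans of_nat_less_iff)
      define t where "t = - \<tau> / real (Suc k)"
      have t: "t < 0" "- 1 < t" using \<open>\<tau> > 0\<close> k by (auto simp: t_def field_simps)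
      have "sin t < 0" using t pi_gt3 sin_gt_zero[of "- t"] by simp
      then have ne: "exp (\<i> * of_real t) \<noteq> 1"
      proof -
        have "Im (exp (\<i> * of_real t)) = sin t" by (simp add: Im_exp)
        then show ?thesis using \<open>sin t < 0\<close> by (metis less_irrefl one_complex.simps(2))
      qed
      have a: "act_fun (mat 1, n k) \<phi> m = exp (\<i> * of_real t) * \<phi> m" for \<phi>
        unfolding act_fun_def using weight_pos[OF m] by (simp only: fst_conv snd_conv orbit_act_1 tr t_def) simp
      have "(exp (\<i> * of_real t) - 1) * (cutoff m - f m) = 0"
        using all[rule_format, of k] unfolding a by (simp add: algebra_simps)
      then show "cutoff m = f m" using ne by simp
    qed
    then have "AE m in orbit_measure. ennreal ((cmod (cutoff m))\<^sup>2) = ennreal ((cmod (f m))\<^sup>2)"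
      by (rule eventually_mono) simp
    from nn_integral_cong_AE[OF this] have "square_integrable (cutoff :: 'n cmat \<Rightarrow> complex)"
      using f(1) measurable_cutoff by (simp add: square_integrable_iff)
    then show False using not_square_integrable_cutoff by blast
  qed
qed

section \<open>Failure of unitarity\<close>

text \<open>If v exceeded u at m, two constants a < b would separate them on a bounded
  neighbourhood, whose part in the orbit has positive finite measure; integrating there contradicts
  the hypothesis. The one-sided form is applied in both directions to get equality.\<close>

lemma le_of_nn_integral_orbit_le:
  fixes u v :: "'n::{finite,wellorder} cmat \<Rightarrow> real"
  assumes u: "continuous_on UNIV u" "\<And>m. u m \<ge> 0" and v: "continuous_on UNIV v" "\<And>m. v m \<ge> 0"
    and le: "\<And>A. A \<in> sets borel \<Longrightarrow> bounded A \<Longrightarrow>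
      (\<integral>\<^sup>+ m. ennreal (v m) * indicator A m \<partial>orbit_measure) \<le>
      (\<integral>\<^sup>+ m. ennreal (u m) * indicator A m \<partial>orbit_measure)"
    and m: "m \<in> orbit0"
  shows "v m \<le> u m"
proof (rule ccontr)
  let ?M = "orbit_measure :: 'n cmat measure"
  assume "\<not> v m \<le> u m"
  then obtain b where b: "u m < b" "b < v m" using dense by (metis not_le)
  then obtain a where a: "u m < a" "a < b" using dense by metis
  have a0: "a \<ge> 0" using a u(2)[of m] by linarith
  define A where "A = {x. u x < a} \<inter> {x. b < v x} \<inter> ball m 1"
  have A: "open A"
    unfolding A_def using u(1) v(1) by (intro open_Int open_Collect_less open_ball continuous_on_const)
  have "bounded A" unfolding A_def by (rule bounded_subset[OF bounded_ball]) blast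
  have Ao: "A \<inter> orbit0 \<in> sets ?M" using A by (intro Int_orbit0_sets borel_open)
  have "m \<in> A" using a b by (simp add: A_def)
  then have pos: "emeasure ?M (A \<inter> orbit0) > 0" using emeasure_orbit_open_pos[OF A _ m] by blast
  have fin: "emeasure ?M (A \<inter> orbit0) < \<infinity>"
    using Ao \<open>bounded A\<close> by (intro emeasure_orbit_bounded_finite) (auto intro: bounded_subset)
  have "ennreal b * emeasure ?M (A \<inter> orbit0) = (\<integral>\<^sup>+ x. ennreal b * indicator (A \<inter> orbit0) x \<partial>?M)"
    using Ao by (simp add: nn_integral_cmult)
  also have "\<dots> \<le> (\<integral>\<^sup>+ x. ennreal (v x) * indicator A x \<partial>?M)"
    by (intro nn_integral_mono) (auto simp: A_def indicator_def intro!: ennreal_leI)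
  also have "\<dots> \<le> (\<integral>\<^sup>+ x. ennreal (u x) * indicator A x \<partial>?M)"
    using A \<open>bounded A\<close> by (intro le) auto
  also have "\<dots> \<le> (\<integral>\<^sup>+ x. ennreal a * indicator (A \<inter> orbit0) x \<partial>?M)"
    by (intro nn_integral_mono) (auto simp: A_def indicator_def intro!: ennreal_leI)
  also have "\<dots> = ennreal a * emeasure ?M (A \<inter> orbit0)"
    using Ao by (simp add: nn_integral_cmult)
  finally have *: "ennreal b * emeasure ?M (A \<inter> orbit0) \<le> ennreal a * emeasure ?M (A \<inter> orbit0)" .
  obtain e where "emeasure ?M (A \<inter> orbit0) = ennreal e" "e > 0"
    using pos fin by (cases "emeasure ?M (A \<inter> orbit0)") auto
  then show False using * a a0 by (simp add: ennreal_mult[symmetric])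
qed

text \<open>Preserving the norms of suitable test functions equates the integrals of two continuous
  densities over all bounded Borel sets, hence the densities on the orbit. Evaluation at
  \<open>orbit_act s m\<close> gives the claim.\<close>

lemma unitary_orbit_act_homogeneous:
  fixes s :: "'n::{finite,wellorder} cmat"
  assumes s: "s \<in> lower_tri" and U: "unitary (rep_op (s, 0))"
  obtains c where "\<And>m. m \<in> orbit0 \<Longrightarrow>
    c * norm (orbit_act s m) ^ (CARD('n))\<^sup>2 = norm m ^ (CARD('n))\<^sup>2"
proof -
  let ?M = "orbit_measure :: 'n cmat measure"
  define d where "d = (CARD('n))\<^sup>2"
  define r where "r = matrix_inv s"
  have r: "r \<in> lower_tri" unfolding r_def by (rule lower_tri_inv[OF s])
  have rs: "orbit_act r (orbit_act s m) = m" for m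
    unfolding r_def by (rule orbit_act_inv[OF s])
  have g: "(s, 0) \<in> carrier P_group" using s by (simp add: P_group_carrier)
  obtain c where c: "c > 0" "\<And>F. F \<in> borel_measurable ?M \<Longrightarrow>
      (\<integral>\<^sup>+ m. F (orbit_act s m) \<partial>?M) = ennreal c * (\<integral>\<^sup>+ m. F m \<partial>?M)"
    using nn_integral_orbit_act[OF s] by metis
  define u where "u = (\<lambda>m :: 'n cmat. c * norm m ^ d)"
  define v where "v = (\<lambda>m :: 'n cmat. norm (orbit_act r m) ^ d)"
  have eq: "(\<integral>\<^sup>+ m. ennreal (u m) * indicator A m \<partial>?M) = (\<integral>\<^sup>+ m. ennreal (v m) * indicator A m \<partial>?M)"
    if A: "A \<in> sets borel" "bounded A" for A
  proof -
    have [measurable]: "A \<in> sets borel" by fact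
    \<comment> \<open>The factor is chosen so that the action turns it into \<open>weight m\<close>,
      which cancels the denominator of the multiplier.\<close>
    define \<phi> where "\<phi> = (\<lambda>m. complex_of_real (weight (orbit_act r m) * indicator A m))"
    have \<phi>: "\<phi> \<in> borel_measurable ?M"
      unfolding \<phi>_def by (intro measurable_borel_orbit_measure) measurable
    have \<phi>2: "(\<integral>\<^sup>+ m. ennreal ((cmod (\<phi> m))\<^sup>2) \<partial>?M) = (\<integral>\<^sup>+ m. ennreal (v m) * indicator A m \<partial>?M)"
    proof (rule nn_integral_cong)
      fix m assume "m \<in> space ?M"
      then have "orbit_act r m \<in> orbit0" using orbit_act_orbit0[OF r] by simp
      then have "orbit_act r m \<noteq> 0" using zero_notin_orbit0 by metis
      then show "ennreal ((cmod (\<phi> m))\<^sup>2) = ennreal (v m) * indicator A m"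
        by (auto simp: \<phi>_def v_def norm_mult power_mult_distrib weight_power2 d_def indicator_def)
    qed
    obtain K where K: "K > 0" "\<And>m. norm (orbit_act r m) \<le> K * norm m"
      using norm_orbit_act_bound by metis
    obtain B where B: "B > 0" "\<And>m. m \<in> A \<Longrightarrow> norm m \<le> B"
      using A(2) by (auto simp: bounded_pos)
    have "(\<integral>\<^sup>+ m. ennreal (v m) * indicator A m \<partial>?M) \<le> (\<integral>\<^sup>+ m. ennreal ((K * B) ^ d) * indicator (A \<inter> orbit0) m \<partial>?M)"
    proof (rule nn_integral_mono)
      fix m assume "m \<in> space ?M"
      moreover have "v m \<le> (K * B) ^ d" if "m \<in> A"
      proof -
        have "norm (orbit_act r m) \<le> K * B"
          using K(2)[of m] mult_left_mono[OF B(2)[OF that], of K] K(1) by linarith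
        then show ?thesis unfolding v_def by (rule power_mono) simp
      qed
      ultimately show "ennreal (v m) * indicator A m \<le> ennreal ((K * B) ^ d) * indicator (A \<inter> orbit0) m"
        by (auto simp: indicator_def intro!: ennreal_leI)
    qed
    also have "\<dots> = ennreal ((K * B) ^ d) * emeasure ?M (A \<inter> orbit0)"
      using Int_orbit0_sets[OF A(1)] by (simp add: nn_integral_cmult)
    also have "\<dots> < \<infinity>"
    proof -
      have "emeasure ?M (A \<inter> orbit0) < \<infinity>"
        using A by (intro emeasure_orbit_bounded_finite Int_orbit0_sets) (auto intro: bounded_subset)
      then show ?thesis by (simp add: ennreal_mult_less_top)
    qed
    finally have sq: "square_integrable \<phi>"
      using \<phi> by (simp add: square_integrable_iff \<phi>2)
    have "norm (rep_op (s, 0) (abs_orbit_L2 \<phi>)) = norm (abs_orbit_L2 \<phi>)"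
      using U unfolding unitary_def norm_orbit_L2_def inner_orbit_L2_def by simp
    then have "norm (abs_orbit_L2 (act_fun (s, 0) \<phi>)) = norm (abs_orbit_L2 \<phi>)"
      by (simp only: rep_op_abs[OF g sq])
    then have "(\<integral>\<^sup>+ m. ennreal ((cmod (act_fun (s, 0) \<phi> m))\<^sup>2) \<partial>?M) = (\<integral>\<^sup>+ m. ennreal ((cmod (\<phi> m))\<^sup>2) \<partial>?M)"
      using norm_abs_orbit_L2[OF sq] norm_abs_orbit_L2[OF square_integrable_act_fun[OF g sq]] by metis
    moreover have "(\<integral>\<^sup>+ m. ennreal ((cmod (act_fun (s, 0) \<phi> m))\<^sup>2) \<partial>?M) =
        (\<integral>\<^sup>+ m. ennreal ((weight (orbit_act s m))\<^sup>2) * indicator A (orbit_act s m) \<partial>?M)"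
    proof (rule nn_integral_cong)
      fix m assume "m \<in> space ?M"
      then have m: "m \<in> orbit0" by simp
      have "cmod (act_fun (s, 0) \<phi> m) = weight (orbit_act s m) * indicator A (orbit_act s m)"
        unfolding cmod_act_fun[OF g m] using weight_pos[OF m] by (simp add: \<phi>_def rs norm_mult)
      then show "ennreal ((cmod (act_fun (s, 0) \<phi> m))\<^sup>2) =
          ennreal ((weight (orbit_act s m))\<^sup>2) * indicator A (orbit_act s m)"
        by (simp add: indicator_def)
    qed
    moreover have "\<dots> = ennreal c * (\<integral>\<^sup>+ m. ennreal ((weight m)\<^sup>2) * indicator A m \<partial>?M)"
      by (rule c(2)) (intro measurable_borel_orbit_measure, measurable)
    moreover have "\<dots> = (\<integral>\<^sup>+ m. ennreal c * (ennreal ((weight m)\<^sup>2) * indicator A m) \<partial>?M)"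
      by (rule nn_integral_cmult[symmetric]) (intro measurable_borel_orbit_measure, measurable)
    moreover have "\<dots> = (\<integral>\<^sup>+ m. ennreal (u m) * indicator A m \<partial>?M)"
    proof (rule nn_integral_cong)
      fix m assume "m \<in> space ?M"
      then have "m \<noteq> 0" using zero_notin_orbit0 by auto
      then show "ennreal c * (ennreal ((weight m)\<^sup>2) * indicator A m) = ennreal (u m) * indicator A m"
        using c(1) by (simp add: u_def weight_power2 d_def ennreal_mult mult.assoc)
    qed
    ultimately show ?thesis using \<phi>2 by simp
  qed
  have cont: "continuous_on UNIV u" "continuous_on UNIV v"
    unfolding u_def v_def by (intro continuous_intros continuous_orbit_act)+
  have nonneg: "u m \<ge> 0" "v m \<ge> 0" for m using c(1) by (simp_all add: u_def v_def)
  have uv: "u m = v m" if "m \<in> orbit0" for m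
    using le_of_nn_integral_orbit_le[OF cont(1) nonneg(1) cont(2) nonneg(2) _ that]
      le_of_nn_integral_orbit_le[OF cont(2) nonneg(2) cont(1) nonneg(1) _ that] eq by simp
  show thesis
  proof (rule that)
    fix m :: "'n cmat" assume "m \<in> orbit0"
    then have "u (orbit_act s m) = v (orbit_act s m)" by (intro uv orbit_act_orbit0[OF s])
    then show "c * norm (orbit_act s m) ^ (CARD('n))\<^sup>2 = norm m ^ (CARD('n))\<^sup>2"
      by (simp add: u_def v_def rs d_def)
  qed
qed

text \<open>Applying \<open>D 2\<close> repeatedly leads from the parameter 1 to 2 and 4, so a
  constant ratio would put the norms N 1, N 2, N 4 in geometric progression. As the squared norm is
  x^4 + p - 1, this reads p (p + 255) = (p + 15)^2, whence p = 1.\<close>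

lemma nonunitary_rep_op:
  assumes "CARD('n::{finite,wellorder}) > 1"
  shows "nonunitary_rep P_group (rep_op :: _ \<Rightarrow> 'n orbit_L2 \<Rightarrow> _)"
  unfolding nonunitary_rep_def
proof
  fix i0 :: 'n
  define D where "D = (\<lambda>x::real. (\<chi> i j. if i = j then (if i = i0 then of_real x else 1) else 0) :: 'n cmat)"
  have D: "D x \<in> lower_tri" if "x > 0" for x
    using that by (auto simp: D_def lower_tri_def)
  have gD: "gram (D x) $ i $ j = (if i = j then (if i = i0 then \<i> * of_real (x\<^sup>2) else \<i>) else 0)" for x i j
    by (simp add: gram_nth D_def if_distrib[of "\<lambda>z. z * _"] if_distrib[of cnj] power2_eq_square cong: if_cong)
  have act: "orbit_act (D y) (gram (D x)) = gram (D (x * y))" for x y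
  proof -
    have "D x ** D y = D (x * y)"
      by (simp add: D_def vec_eq_iff matrix_matrix_mult_def if_distrib[of "\<lambda>z. z * _"] cong: if_cong)
    then show ?thesis by (simp flip: gram_mult)
  qed
  define p where "p = real CARD('n)"
  have nm: "(norm (gram (D x)))\<^sup>2 = x ^ 4 + (p - 1)" for x
  proof -
    have row: "(norm (gram (D x) $ i))\<^sup>2 = (if i = i0 then x ^ 4 else 1)" for i
    proof -
      have "(norm (gram (D x) $ i))\<^sup>2 = (\<Sum>j\<in>UNIV. (cmod (gram (D x) $ i $ j))\<^sup>2)"
        by (simp add: norm_vec_def L2_set_def sum_nonneg)
      also have "\<dots> = (\<Sum>j\<in>UNIV. if j = i then (if i = i0 then x ^ 4 else 1) else 0)"
        by (intro sum.cong) (auto simp: gD norm_mult norm_power simp flip: power_mult)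
      finally show ?thesis by simp
    qed
    have "(norm (gram (D x)))\<^sup>2 = (\<Sum>i\<in>UNIV. (norm (gram (D x) $ i))\<^sup>2)"
      by (simp add: norm_vec_def L2_set_def sum_nonneg)
    also have "\<dots> = x ^ 4 + (\<Sum>i\<in>UNIV - {i0}. 1)"
      unfolding row by (subst sum.remove[of _ i0]) (auto intro!: sum.cong)
    also have "\<dots> = x ^ 4 + (p - 1)"
      by (simp add: p_def card_Diff_singleton of_nat_diff)
    finally show ?thesis .
  qed
  assume "\<forall>g\<in>carrier P_group. unitary (rep_op g :: 'n orbit_L2 \<Rightarrow> _)"
  then have "unitary (rep_op (D 2, 0))"
    using D[of 2] by (force simp: P_group_carrier)
  then obtain c where c: "\<And>m. m \<in> orbit0 \<Longrightarrow>
      c * norm (orbit_act (D 2) m) ^ (CARD('n))\<^sup>2 = norm m ^ (CARD('n))\<^sup>2"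
    using unitary_orbit_act_homogeneous[OF D[of 2]] by auto
  have orb: "gram (D x) \<in> orbit0" if "x > 0" for x
    using D[OF that] by (simp add: orbit0_eq_gram)
  define N where "N = (\<lambda>x. norm (gram (D x)))"
  have "c * N 2 ^ (CARD('n))\<^sup>2 = N 1 ^ (CARD('n))\<^sup>2" "c * N 4 ^ (CARD('n))\<^sup>2 = N 2 ^ (CARD('n))\<^sup>2"
    using c[OF orb[of 1]] c[OF orb[of 2]] by (simp_all add: act N_def)
  \<comment> \<open>Eliminates c by multiplication, without division by it.\<close>
  moreover have "x * z = y * y" if "c * y = x" "c * z = y" for x y z
    by (simp add: that[symmetric] mult_ac)
  ultimately have "(N 1 * N 4) ^ (CARD('n))\<^sup>2 = (N 2 * N 2) ^ (CARD('n))\<^sup>2"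
    unfolding power_mult_distrib by blast
  then have "N 1 * N 4 = N 2 * N 2"
    by (subst (asm) power_eq_iff_eq_base) (auto simp: N_def)
  then have "(N 1)\<^sup>2 * (N 4)\<^sup>2 = (N 2)\<^sup>2 * (N 2)\<^sup>2"
    by (metis power_mult_distrib)
  then have "p * (p + 255) = (p + 15) * (p + 15)"
    by (simp add: N_def nm add.commute)
  then have "p = 1" by (simp add: algebra_simps)
  then show False using assms by (simp add: p_def)
qed

theorem theorem1:
  fixes \<pi> :: "'n::{finite,wellorder} cmat \<times> 'n cmat \<Rightarrow> 'n orbit_L2 \<Rightarrow> 'n orbit_L2"
  assumes "CARD('n) > 1"
    and "\<pi> = (\<lambda>(s, n). T_a s \<circ> T_exp n)"
  shows "representation P_group \<pi> \<and> bounded_rep P_group \<pi> \<and>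
         special_rep P_group \<pi> \<and> nonunitary_rep P_group \<pi>"
  unfolding assms(2)
  by (intro conjI representation_rep_op bounded_rep_op special_rep_op nonunitary_rep_op assms(1))

end
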